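(* Let $\mathcal{H}$ be an infinite dimensional separable complex Hilbert space, let $m,n\geq 1$ be integers, and let $T\in B(\mathcal{H})$ be $(m,|T^n|^2)$-expansive, where $|T^n|^2=T^{*n}T^n$. With respect to the orthogonal decomposition $\mathcal{H}=\overline{T^n(\mathcal{H})}\oplus\ker(T^{*n})$ write $$T^n=\begin{pmatrix}T_1^n & X\\ 0&0\end{pmatrix},\qquad T_1=T|_{\overline{T^n(\mathcal{H})}},$$ let $T_1^n=U_1P_1$ be the polar decomposition of $T_1^n$, and define $$A=\begin{pmatrix}P_1^{1/2}U_1P_1^{1/2} & P_1^{1/2}X\\ 0&0\end{pmatrix},\quad B=\begin{pmatrix}P_1U_1 & P_1X\\ 0&0\end{pmatrix},$$ $$C=\begin{pmatrix}P_1 & P_1^{1/2}U_1^*X\\ X^*U_1P_1^{1/2} & X^*X\end{pmatrix},\quad D=\begin{pmatrix}I_1 & U_1^*X\\ X^*U_1 & X^*X\end{pmatrix}.$$ Then $A$ is $(m,C)$-expansive and $B$ is $(m,D)$-expansive. If, in addition, $$\begin{pmatrix}I_1 & X\\ X^* & X^*X\end{pmatrix}\geq I,$$ then $B$ is $m$-expansive, and there exists an equivalent norm $\|\cdot\|_Q$ on $\mathcal{H}$, namely $\|x\|_Q^2=\langle Qx,x\rangle$ with $Q=P_1\oplus I_2$, such that $A$ is $m$-expansive in this norm (equivalently, $A$ is $(m,Q)$-expansive).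
   Context: $B(\mathcal{H})$ is the algebra of bounded linear operators on $\mathcal{H}$ with identity $I$; $I_1$ and $I_2$ denote the identities on $\overline{T^n(\mathcal{H})}$ and $\ker(T^{*n})$ respectively. For $S,Y\in B(\mathcal{H})$ and an integer $m\geq 1$, $S$ is $(m,Y)$-expansive if $\sum_{j=0}^m(-1)^j\binom{m}{j}S^{*j}YS^j\leq 0$; $S$ is $m$-expansive if it is $(m,I)$-expansive. Here $X$ is the operator from $\ker(T^{*n})$ to $\overline{T^n(\mathcal{H})}$ given by the restriction of $T^n$ to $\ker(T^{*n})$. For $T$ an $(m,|T^n|^2)$-expansive operator, in the polar decomposition $T_1^n=U_1P_1$ the operator $U_1$ is an isometry and $P_1\geq 0$ is invertible on $\overline{T^n(\mathcal{H})}$. The norm $\|\cdot\|_Q$ comes from the inner product $\langle x,y\rangle_Q=\langle Qx,y\rangle$, and "$A$ is $m$-expansive in the norm $\|\cdot\|_Q$" means $\sum_{j=0}^m(-1)^j\binom{m}{j}\|A^jx\|_Q^2\leq 0$ for all $x\in\mathcal{H}$. *)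

theory Defs
  imports "HOL-Analysis.Analysis"
begin

class complex_vector = real_vector +
  fixes scaleC :: "complex \<Rightarrow> 'a \<Rightarrow> 'a" (infixr \<open>*\<^sub>C\<close> 75)
  assumes scaleC_add_right: "c *\<^sub>C (x + y) = c *\<^sub>C x + c *\<^sub>C y"
    and scaleC_add_left: "(c + d) *\<^sub>C x = c *\<^sub>C x + d *\<^sub>C x"
    and scaleC_scaleC: "c *\<^sub>C (d *\<^sub>C x) = (c * d) *\<^sub>C x"
    and scaleR_scaleC: "r *\<^sub>R x = complex_of_real r *\<^sub>C x"

lemma vector_space_scaleC: "vector_space ((*\<^sub>C) :: complex \<Rightarrow> 'a \<Rightarrow> 'a::complex_vector)"
proof
  fix c d :: complex and x y :: 'a
  show "c *\<^sub>C (x + y) = c *\<^sub>C x + c *\<^sub>C y" by (rule scaleC_add_right)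
  show "(c + d) *\<^sub>C x = c *\<^sub>C x + d *\<^sub>C x" by (rule scaleC_add_left)
  show "c *\<^sub>C d *\<^sub>C x = (c * d) *\<^sub>C x" by (rule scaleC_scaleC)
  show "1 *\<^sub>C x = x" using scaleR_scaleC[of 1 x] by simp
qed

text \<open>The inner product is linear in its first argument. It is positive definite because it
  induces the norm.\<close>

class complex_inner = complex_vector + real_normed_vector +
  fixes cinner :: "'a \<Rightarrow> 'a \<Rightarrow> complex"
  assumes cinner_add_left: "cinner (x + y) z = cinner x z + cinner y z"
    and cinner_scaleC_left: "cinner (c *\<^sub>C x) y = c * cinner x y"
    and cinner_commute: "cinner x y = cnj (cinner y x)"
    and norm_eq_sqrt_cinner: "norm x = sqrt (Re (cinner x x))"

class complex_hilbert_space = complex_inner + complete_space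

definition infinite_dimensional :: "'a::complex_vector itself \<Rightarrow> bool" where
  "infinite_dimensional _ \<longleftrightarrow> \<not> (\<exists>B :: 'a set. finite B \<and> module.span (*\<^sub>C) B = UNIV)"

text \<open>An operator from a closed subspace \<open>M\<close> to a closed subspace \<open>N\<close> is a function on the ambient
  space of which only the values on \<open>M\<close> are relevant. The choice \<open>M = N = UNIV\<close> gives the
  operators on the whole space.\<close>

definition bounded_op_on :: "'a::complex_inner set \<Rightarrow> 'a set \<Rightarrow> ('a \<Rightarrow> 'a) \<Rightarrow> bool" where
  "bounded_op_on M N F \<longleftrightarrow>
     (\<forall>x\<in>M. F x \<in> N) \<and>
     (\<forall>x\<in>M. \<forall>y\<in>M. F (x + y) = F x + F y) \<and>
     (\<forall>c. \<forall>x\<in>M. F (c *\<^sub>C x) = c *\<^sub>C F x) \<and>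
     (\<exists>K. \<forall>x\<in>M. norm (F x) \<le> K * norm x)"

abbreviation bounded_op :: "('a::complex_inner \<Rightarrow> 'a) \<Rightarrow> bool" where
  "bounded_op \<equiv> bounded_op_on UNIV UNIV"

definition adjoint_on :: "'a::complex_inner set \<Rightarrow> 'a set \<Rightarrow> ('a \<Rightarrow> 'a) \<Rightarrow> 'a \<Rightarrow> 'a" where
  "adjoint_on M N F =
     (SOME G. (\<forall>y\<in>N. G y \<in> M) \<and> (\<forall>x\<in>M. \<forall>y\<in>N. cinner (F x) y = cinner x (G y)))"

abbreviation cadjoint :: "('a::complex_inner \<Rightarrow> 'a) \<Rightarrow> 'a \<Rightarrow> 'a" where
  "cadjoint \<equiv> adjoint_on UNIV UNIV"

text \<open>Membership of the quadratic form in \<open>\<real>\<^sub>\<ge>\<^sub>0\<close> includes that the form is real-valued, so over the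
  complex scalars positive operators are self-adjoint.\<close>

definition positive_on :: "'a::complex_inner set \<Rightarrow> ('a \<Rightarrow> 'a) \<Rightarrow> bool" where
  "positive_on M F \<longleftrightarrow> bounded_op_on M M F \<and> (\<forall>x\<in>M. cinner (F x) x \<in> \<real>\<^sub>\<ge>\<^sub>0)"

definition op_le :: "('a::complex_inner \<Rightarrow> 'a) \<Rightarrow> ('a \<Rightarrow> 'a) \<Rightarrow> bool" where
  "op_le F G \<longleftrightarrow> positive_on UNIV (\<lambda>x. G x - F x)"

definition positive_sqrt_on :: "'a::complex_inner set \<Rightarrow> ('a \<Rightarrow> 'a) \<Rightarrow> ('a \<Rightarrow> 'a) \<Rightarrow> bool" where
  "positive_sqrt_on M F R \<longleftrightarrow> positive_on M R \<and> (\<forall>x\<in>M. R (R x) = F x)"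

definition partial_isometry_on :: "'a::complex_inner set \<Rightarrow> ('a \<Rightarrow> 'a) \<Rightarrow> bool" where
  "partial_isometry_on M U \<longleftrightarrow> bounded_op_on M M U \<and>
     (\<forall>x\<in>M. (\<forall>z\<in>M. U z = 0 \<longrightarrow> cinner x z = 0) \<longrightarrow> norm (U x) = norm x)"

text \<open>\<open>F = U P\<close> with \<open>P = (F\<^sup>* F)\<^sup>1\<^sup>/\<^sup>2\<close> and \<open>U\<close> a partial isometry with the same kernel as \<open>P\<close>; these
  conditions determine \<open>U\<close> and \<open>P\<close> on \<open>M\<close>.\<close>

definition polar_decomposition_on ::
    "'a::complex_inner set \<Rightarrow> ('a \<Rightarrow> 'a) \<Rightarrow> ('a \<Rightarrow> 'a) \<Rightarrow> ('a \<Rightarrow> 'a) \<Rightarrow> bool" where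
  "polar_decomposition_on M F U P \<longleftrightarrow>
     positive_sqrt_on M (adjoint_on M M F \<circ> F) P \<and>
     partial_isometry_on M U \<and>
     (\<forall>x\<in>M. U x = 0 \<longleftrightarrow> P x = 0) \<and>
     (\<forall>x\<in>M. F x = U (P x))"

definition orth_proj :: "'a::complex_inner set \<Rightarrow> 'a \<Rightarrow> 'a" where
  "orth_proj M x = (THE y. y \<in> M \<and> (\<forall>z\<in>M. cinner (x - y) z = 0))"

text \<open>The operator matrix with rows \<open>(F11, F12)\<close> and \<open>(F21, F22)\<close> with respect to an orthogonal
  decomposition of the space into \<open>M\<close> and \<open>N\<close>, in this order.\<close>

definition block_op :: "'a::complex_inner set \<Rightarrow> 'a set \<Rightarrow>
    ('a \<Rightarrow> 'a) \<Rightarrow> ('a \<Rightarrow> 'a) \<Rightarrow> ('a \<Rightarrow> 'a) \<Rightarrow> ('a \<Rightarrow> 'a) \<Rightarrow> 'a \<Rightarrow> 'a" where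
  "block_op M N F11 F12 F21 F22 x =
     (F11 (orth_proj M x) + F12 (orth_proj N x)) + (F21 (orth_proj M x) + F22 (orth_proj N x))"

definition expansive :: "nat \<Rightarrow> ('a::complex_inner \<Rightarrow> 'a) \<Rightarrow> ('a \<Rightarrow> 'a) \<Rightarrow> bool" where
  "expansive m Y S \<longleftrightarrow> bounded_op S \<and> bounded_op Y \<and>
     op_le (\<lambda>x. \<Sum>j=0..m. ((-1) ^ j * real (m choose j)) *\<^sub>R
                 (cadjoint S ^^ j) (Y ((S ^^ j) x)))
           (\<lambda>x. 0)"

definition is_inner_product :: "('a::complex_vector \<Rightarrow> 'a \<Rightarrow> complex) \<Rightarrow> bool" where
  "is_inner_product b \<longleftrightarrow>
     (\<forall>x y z. b (x + y) z = b x z + b y z) \<and>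
     (\<forall>c x y. b (c *\<^sub>C x) y = c * b x y) \<and>
     (\<forall>x y. b x y = cnj (b y x)) \<and>
     (\<forall>x. b x x \<in> \<real>\<^sub>\<ge>\<^sub>0) \<and>
     (\<forall>x. b x x = 0 \<longrightarrow> x = 0)"

definition inner_wrt :: "('a::complex_inner \<Rightarrow> 'a) \<Rightarrow> 'a \<Rightarrow> 'a \<Rightarrow> complex" where
  "inner_wrt Q x y = cinner (Q x) y"

definition norm_wrt :: "('a::complex_inner \<Rightarrow> 'a) \<Rightarrow> 'a \<Rightarrow> real" where
  "norm_wrt Q x = sqrt (Re (inner_wrt Q x x))"

definition is_norm :: "('a::complex_vector \<Rightarrow> real) \<Rightarrow> bool" where
  "is_norm p \<longleftrightarrow>
     (\<forall>x. p x \<ge> 0) \<and> (\<forall>x. p x = 0 \<longleftrightarrow> x = 0) \<and>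
     (\<forall>x y. p (x + y) \<le> p x + p y) \<and> (\<forall>c x. p (c *\<^sub>C x) = cmod c * p x)"

definition equivalent_norm :: "('a::complex_inner \<Rightarrow> real) \<Rightarrow> bool" where
  "equivalent_norm p \<longleftrightarrow> is_norm p \<and>
     (\<exists>a b. a > 0 \<and> b > 0 \<and> (\<forall>x. a * norm x \<le> p x \<and> p x \<le> b * norm x))"

definition expansive_in_norm ::
    "nat \<Rightarrow> ('a::complex_inner \<Rightarrow> real) \<Rightarrow> ('a \<Rightarrow> 'a) \<Rightarrow> bool" where
  "expansive_in_norm m p S \<longleftrightarrow>
     (\<forall>x. (\<Sum>j=0..m. (-1) ^ j * real (m choose j) * (p ((S ^^ j) x))\<^sup>2) \<le> 0)"

end

theory Submission
  imports Defs
begin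

text \<open>
  Put \<open>W = T\<^sup>n\<close>, \<open>P = P\<^sub>1\<close> and \<open>U = U\<^sub>1\<close>. The operators \<open>A\<close> and \<open>B\<close> are both similar to \<open>W\<close>: for
  \<open>R = P\<^sup>1\<^sup>/\<^sup>2 \<oplus> I\<close> the factorisation \<open>W = U P\<close> on \<open>M\<close> gives \<open>A R = R W\<close> and \<open>B R\<^sup>2 = R\<^sup>2 W\<close>. The weights
  \<open>C\<close> and \<open>D\<close> are Gram matrices of the rows \<open>(U P\<^sup>1\<^sup>/\<^sup>2, X) = W R\<^sup>-\<^sup>1\<close> and \<open>(U, X) = W R\<^sup>-\<^sup>2\<close>. So the
  expansivity sum of \<open>A\<close> with weight \<open>C\<close> at \<open>R x\<close>, and that of \<open>B\<close> with weight \<open>D\<close> at \<open>R\<^sup>2 x\<close>, are both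
  the expansivity sum of \<open>W\<close> with weight \<open>W\<^sup>* W\<close> at \<open>x\<close>. Both claims follow from one lemma,
  \<open>expansive_gram_block_op\<close>, about the similarity \<open>G \<oplus> I\<close> with surjective \<open>G\<close>.

  Three things make this argument work. First, \<open>W\<close> inherits expansivity from \<open>T\<close>, since
  \<open>(1 - x\<^sup>n)\<^sup>m\<close> is the product of \<open>(1 - x)\<^sup>m\<close> and a polynomial with nonnegative coefficients
  (\<open>expansive_power_form\<close>). Secondly, the resulting inequality bounds \<open>W\<close> from below on its
  range (\<open>expansive_form_bounded_below\<close>), hence on \<open>M\<close>; therefore \<open>U\<close> is an isometry of \<open>M\<close> and \<open>P\<close> maps
  \<open>M\<close> onto \<open>M\<close> (\<open>polar_bounded_below\<close>), and so does \<open>P\<^sup>1\<^sup>/\<^sup>2\<close>. Thirdly, the adjoints that occur have to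
  exist, which rests on the projection theorem and the Riesz representation theorem for closed
  subspaces of a complex Hilbert space.

  The additional inequality says \<open>\<parallel>y + X z\<parallel>\<^sup>2 \<ge> \<parallel>y\<parallel>\<^sup>2 + \<parallel>z\<parallel>\<^sup>2\<close> for all \<open>y\<close> in \<open>M\<close> and \<open>z\<close> in \<open>N\<close>. The choice
  \<open>y = - X z\<close> shows that it forces \<open>N = {0}\<close>. Then \<open>D\<close> has the form \<open>\<parallel>U x\<parallel>\<^sup>2 = \<parallel>x\<parallel>\<^sup>2\<close> of the identity, and
  \<open>C\<close> has the form \<open>\<parallel>P\<^sup>1\<^sup>/\<^sup>2 x\<parallel>\<^sup>2\<close> of \<open>Q\<close>, so the remaining assertions are the two proved before. The norm
  of \<open>Q\<close> is \<open>\<parallel>P\<^sup>1\<^sup>/\<^sup>2 x\<parallel>\<close>, which is equivalent to the original one since \<open>P\<^sup>1\<^sup>/\<^sup>2\<close> is bounded and bounded below.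
\<close>

interpretation scaleC: vector_space "(*\<^sub>C) :: complex \<Rightarrow> 'a \<Rightarrow> 'a::complex_vector"
  by (rule vector_space_scaleC)

section \<open>Complex inner product spaces\<close>

lemma cinner_add_right: "cinner x (y + z) = cinner x y + cinner x z"
  for x :: "'a::complex_inner"
  using cinner_add_left[of y z x] by (metis cinner_commute complex_cnj_add)

lemma cinner_scaleC_right: "cinner x (c *\<^sub>C y) = cnj c * cinner x y"
  for x :: "'a::complex_inner"
  using cinner_scaleC_left[of c y x] by (metis cinner_commute complex_cnj_mult)

lemma cinner_scaleR_left: "cinner (r *\<^sub>R x) y = complex_of_real r * cinner x y"
  for x :: "'a::complex_inner"
  by (simp add: scaleR_scaleC cinner_scaleC_left)

lemma cinner_scaleR_right: "cinner x (r *\<^sub>R y) = complex_of_real r * cinner x y"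
  for x :: "'a::complex_inner"
  by (simp add: scaleR_scaleC cinner_scaleC_right)

lemma cinner_zero_left [simp]: "cinner 0 y = 0" for y :: "'a::complex_inner"
  using cinner_scaleR_left[of 0 0 y] by simp

lemma cinner_zero_right [simp]: "cinner y 0 = 0" for y :: "'a::complex_inner"
  using cinner_scaleR_right[of y 0 0] by simp

lemma cinner_minus_left: "cinner (- x) y = - cinner x y" for x :: "'a::complex_inner"
  using cinner_scaleR_left[of "-1" x y] by simp

lemma cinner_minus_right: "cinner x (- y) = - cinner x y" for x :: "'a::complex_inner"
  using cinner_scaleR_right[of x "-1" y] by simp

lemma cinner_diff_left: "cinner (x - y) z = cinner x z - cinner y z"
  for x :: "'a::complex_inner"
  using cinner_add_left[of x "- y" z] by (simp add: cinner_minus_left)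

lemma cinner_diff_right: "cinner x (y - z) = cinner x y - cinner x z"
  for x :: "'a::complex_inner"
  using cinner_add_right[of x y "- z"] by (simp add: cinner_minus_right)

lemma cinner_sum_left: "cinner (\<Sum>i\<in>I. f i) y = (\<Sum>i\<in>I. cinner (f i) y)"
  for y :: "'a::complex_inner"
  by (induction I rule: infinite_finite_induct) (auto simp: cinner_add_left)

lemma cinner_self: "cinner x x = complex_of_real ((norm x)\<^sup>2)"
  for x :: "'a::complex_inner"
proof -
  have "Re (cinner x x) \<ge> 0"
    using norm_ge_zero[of x] by (simp add: norm_eq_sqrt_cinner)
  moreover have "Im (cinner x x) = 0"
    using cinner_commute[of x x] by (metis complex_cnj complex.sel(2) complex_eq_cancel_iff2 neg_equal_zero
        cnj.simps(2))
  ultimately show ?thesis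
    by (simp add: complex_eq_iff norm_eq_sqrt_cinner)
qed

lemma cinner_self_eq_0 [simp]: "cinner x x = 0 \<longleftrightarrow> x = 0" for x :: "'a::complex_inner"
  by (simp add: cinner_self)

lemma cinner_eq_0_commute: "cinner x y = 0 \<longleftrightarrow> cinner y x = 0" for x :: "'a::complex_inner"
  by (metis cinner_commute complex_cnj_zero)

lemma Re_cinner_commute: "Re (cinner x y) = Re (cinner y x)" for x :: "'a::complex_inner"
  by (metis cinner_commute cnj.simps(1))

lemma norm_add_sq: "(norm (x + y))\<^sup>2 = (norm x)\<^sup>2 + 2 * Re (cinner x y) + (norm y)\<^sup>2"
  for x :: "'a::complex_inner"
proof -
  have "(norm (x + y))\<^sup>2 = Re (cinner (x + y) (x + y))"
    by (simp add: cinner_self)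
  then show ?thesis
    using Re_cinner_commute[of x y] by (simp add: cinner_add_left cinner_add_right) (simp add: cinner_self)
qed

lemma norm_diff_sq: "(norm (x - y))\<^sup>2 = (norm x)\<^sup>2 - 2 * Re (cinner x y) + (norm y)\<^sup>2"
  for x :: "'a::complex_inner"
  using norm_add_sq[of x "- y"] by (simp add: cinner_minus_right)

lemma norm_scaleC: "norm (c *\<^sub>C x) = cmod c * norm x" for x :: "'a::complex_inner"
proof -
  have "complex_of_real ((norm (c *\<^sub>C x))\<^sup>2) = c * cnj c * cinner x x"
    by (simp only: cinner_self[symmetric]) (simp add: cinner_scaleC_left cinner_scaleC_right)
  also have "\<dots> = complex_of_real ((cmod c * norm x)\<^sup>2)"
    by (simp only: cinner_self power_mult_distrib of_real_mult complex_norm_square)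
  finally show ?thesis
    by (metis of_real_eq_iff norm_ge_zero mult_nonneg_nonneg power2_eq_iff_nonneg)
qed

text \<open>The triangle inequality for the norm bounds the real part of the inner product; the phase of
  the inner product is absorbed into a unimodular scalar.\<close>

lemma cinner_Cauchy_Schwarz: "cmod (cinner x y) \<le> norm x * norm y"
  for x :: "'a::complex_inner"
proof -
  have *: "Re (cinner u y) \<le> norm u * norm y" for u
  proof -
    have "(norm (u + y))\<^sup>2 \<le> (norm u + norm y)\<^sup>2"
      by (intro power_mono norm_triangle_ineq) auto
    then show ?thesis
      by (simp add: norm_add_sq power2_sum)
  qed
  define c where "c = (if cinner x y = 0 then 1 else cnj (sgn (cinner x y)))"
  have "cmod c = 1"
    by (simp add: c_def norm_sgn)
  moreover have "c * cinner x y = complex_of_real (cmod (cinner x y))"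
  proof (cases "cinner x y = 0")
    case False
    then have "c * cinner x y = cinner x y * cnj (cinner x y) / complex_of_real (cmod (cinner x y))"
      by (simp add: c_def sgn_eq mult.commute)
    also have "\<dots> = complex_of_real (cmod (cinner x y))"
      using False by (simp add: complex_norm_square[symmetric] power2_eq_square)
    finally show ?thesis .
  qed simp
  ultimately show ?thesis
    using *[of "c *\<^sub>C x"] by (simp add: cinner_scaleC_left norm_scaleC)
qed

lemma bounded_linear_cinner_left: "bounded_linear (\<lambda>x. cinner x y)"
  for y :: "'a::complex_inner"
  by (rule bounded_linear_intro[where K = "norm y"])
     (auto simp: cinner_add_left cinner_scaleR_left scaleR_conv_of_real cinner_Cauchy_Schwarz)

lemma closed_cinner_eq_0: "closed {x. cinner x y = 0}"
  for y :: "'a::complex_inner"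
  using linear_continuous_on[OF bounded_linear_cinner_left]
  by (rule closed_Collect_eq) (rule continuous_on_const)

section \<open>Orthogonal projections and adjoints\<close>

definition closed_csubspace :: "'a::complex_inner set \<Rightarrow> bool" where
  "closed_csubspace M \<longleftrightarrow> closed M \<and> scaleC.subspace M"

lemma closed_csubspace_UNIV [simp]: "closed_csubspace UNIV"
  by (simp add: closed_csubspace_def)

lemma closed_csubspace_scaleR: "closed_csubspace M \<Longrightarrow> x \<in> M \<Longrightarrow> r *\<^sub>R x \<in> M"
  by (simp add: closed_csubspace_def scaleR_scaleC scaleC.subspace_scale)

lemma closed_csubspace_ops:
  assumes "closed_csubspace M"
  shows "0 \<in> M" "x \<in> M \<Longrightarrow> y \<in> M \<Longrightarrow> x + y \<in> M" "x \<in> M \<Longrightarrow> y \<in> M \<Longrightarrow> x - y \<in> M"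
    "x \<in> M \<Longrightarrow> c *\<^sub>C x \<in> M" "x \<in> M \<Longrightarrow> - x \<in> M"
  using assms by (auto simp: closed_csubspace_def scaleC.subspace_0 scaleC.subspace_add
      scaleC.subspace_diff scaleC.subspace_scale scaleC.subspace_neg)

text \<open>By the parallelogram law a minimising sequence for the distance from \<open>x\<close> to \<open>M\<close> is a Cauchy
  sequence, because the midpoint of two of its members is no closer to \<open>x\<close> than the infimum.
  Varying its limit inside \<open>M\<close> shows that the difference to \<open>x\<close> is orthogonal to \<open>M\<close>.\<close>

lemma orth_proj_exists:
  fixes x :: "'a::complex_hilbert_space"
  assumes M: "closed_csubspace M"
  shows "\<exists>y\<in>M. \<forall>z\<in>M. cinner (x - y) z = 0"
proof -
  define d where "d = infdist x M"
  have ne: "M \<noteq> {}"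
    using closed_csubspace_ops(1)[OF M] by blast
  have d_le: "d \<le> norm (x - y)" if "y \<in> M" for y
    unfolding d_def using infdist_le[OF that, of x] by (simp add: dist_norm)
  have d0: "d \<ge> 0"
    by (simp add: d_def infdist_nonneg)
  have "\<exists>y\<in>M. norm (x - y) < d + e" if "e > 0" for e
  proof (rule ccontr)
    assume "\<not> ?thesis"
    then have "d + e \<le> dist x y" if "y \<in> M" for y
      using that by (auto simp: dist_norm not_less)
    then have "d + e \<le> (INF y\<in>M. dist x y)"
      using ne by (intro cINF_greatest) auto
    then show False
      using \<open>e > 0\<close> ne by (simp add: d_def infdist_def)
  qed
  then have "\<exists>y\<in>M. norm (x - y) < d + inverse (real (Suc k))" for k
    by simp
  then obtain Y where YM: "\<And>k. Y k \<in> M" and Y: "\<And>k. norm (x - Y k) < d + inverse (real (Suc k))"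
    by metis
  have lim: "(\<lambda>k. norm (x - Y k)) \<longlonglongrightarrow> d"
  proof (rule tendsto_sandwich)
    show "\<forall>\<^sub>F k in sequentially. d \<le> norm (x - Y k)"
      using d_le YM by simp
    show "\<forall>\<^sub>F k in sequentially. norm (x - Y k) \<le> d + inverse (real (Suc k))"
      using Y by (simp add: less_imp_le)
    show "(\<lambda>k. d + inverse (real (Suc k))) \<longlonglongrightarrow> d"
      by (rule LIMSEQ_inverse_real_of_nat_add)
  qed simp
  have parallelogram: "(norm (y - z))\<^sup>2 \<le> 2 * ((norm (x - y))\<^sup>2 - d\<^sup>2) + 2 * ((norm (x - z))\<^sup>2 - d\<^sup>2)"
    if "y \<in> M" "z \<in> M" for y z
  proof -
    have "(1/2) *\<^sub>R (y + z) \<in> M"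
      using M that by (intro closed_csubspace_scaleR closed_csubspace_ops)
    then have "d\<^sup>2 \<le> (norm (x - (1/2) *\<^sub>R (y + z)))\<^sup>2"
      using d_le d0 by (intro power_mono)
    moreover have "(x - y) + (x - z) = 2 *\<^sub>R (x - (1/2) *\<^sub>R (y + z))"
      by (simp add: algebra_simps scaleR_2)
    then have "(norm ((x - y) + (x - z)))\<^sup>2 = 4 * (norm (x - (1/2) *\<^sub>R (y + z)))\<^sup>2"
      by (simp add: power_mult_distrib)
    moreover have "(norm ((x - y) - (x - z)))\<^sup>2 = (norm (y - z))\<^sup>2"
      by (simp add: norm_minus_commute)
    ultimately show ?thesis
      using norm_add_sq[of "x - y" "x - z"] norm_diff_sq[of "x - y" "x - z"] by simp
  qed
  have "Cauchy Y"
  proof (rule CauchyI)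
    fix e :: real assume e: "e > 0"
    have "(\<lambda>k. (norm (x - Y k))\<^sup>2 - d\<^sup>2) \<longlonglongrightarrow> d\<^sup>2 - d\<^sup>2"
      by (intro tendsto_intros lim)
    then have "\<forall>\<^sub>F k in sequentially. (norm (x - Y k))\<^sup>2 - d\<^sup>2 < e\<^sup>2 / 4"
      using e by (intro order_tendstoD(2)) auto
    then obtain K where K: "\<And>k. k \<ge> K \<Longrightarrow> (norm (x - Y k))\<^sup>2 - d\<^sup>2 < e\<^sup>2 / 4"
      by (auto simp: eventually_sequentially)
    have "norm (Y k - Y l) < e" if "k \<ge> K" "l \<ge> K" for k l
    proof -
      have "(norm (Y k - Y l))\<^sup>2 < e\<^sup>2"
        using parallelogram[OF YM YM, of k l] K[OF that(1)] K[OF that(2)] by simp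
      then show ?thesis
        using e by (simp add: power2_less_imp_less)
    qed
    then show "\<exists>K. \<forall>k\<ge>K. \<forall>l\<ge>K. norm (Y k - Y l) < e"
      by blast
  qed
  then obtain y where y: "Y \<longlonglongrightarrow> y"
    using Cauchy_convergent convergent_def by blast
  have yM: "y \<in> M"
    using M YM y closed_sequentially[of M Y y] by (auto simp: closed_csubspace_def)
  have "(\<lambda>k. norm (x - Y k)) \<longlonglongrightarrow> norm (x - y)"
    by (intro tendsto_intros y)
  then have d_eq: "norm (x - y) = d"
    using lim LIMSEQ_unique by blast
  have Re0: "Re (cinner (x - y) z) = 0" if "z \<in> M" for z
  proof (cases "z = 0")
    case False
    define r where "r = Re (cinner (x - y) z)"
    \<comment> \<open>the minimiser of \<open>t \<mapsto> \<parallel>x - y - t z\<parallel>\<^sup>2\<close> over the reals\<close>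
    define t where "t = r / (norm z)\<^sup>2"
    have "y + t *\<^sub>R z \<in> M"
      using M that yM by (intro closed_csubspace_ops closed_csubspace_scaleR)
    then have "d\<^sup>2 \<le> (norm (x - (y + t *\<^sub>R z)))\<^sup>2"
      using d_le d0 by (intro power_mono)
    also have "x - (y + t *\<^sub>R z) = (x - y) - t *\<^sub>R z"
      by simp
    also have "(norm \<dots>)\<^sup>2 = d\<^sup>2 - 2 * (t * r) + (t * norm z)\<^sup>2"
      by (simp add: norm_diff_sq[of "x - y"] d_eq r_def cinner_scaleR_right power_mult_distrib)
    also have "\<dots> = d\<^sup>2 - r\<^sup>2 / (norm z)\<^sup>2"
      using False by (simp add: t_def field_simps power2_eq_square)
    finally have "r\<^sup>2 / (norm z)\<^sup>2 \<le> 0"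
      by simp
    then show ?thesis
      using False by (simp add: r_def divide_le_0_iff)
  qed simp
  have "cinner (x - y) z = 0" if "z \<in> M" for z
    using Re0[OF that] Re0[OF closed_csubspace_ops(4)[OF M that], of \<i>]
    by (simp add: cinner_scaleC_right complex_eq_iff)
  then show ?thesis
    using yM by blast
qed

lemma orth_proj_unique:
  fixes x :: "'a::complex_inner"
  assumes M: "closed_csubspace M" and y: "y \<in> M" "\<And>z. z \<in> M \<Longrightarrow> cinner (x - y) z = 0"
  shows "orth_proj M x = y"
  unfolding orth_proj_def
proof (rule the_equality)
  show "y \<in> M \<and> (\<forall>z\<in>M. cinner (x - y) z = 0)"
    using y by blast
  fix y' assume y': "y' \<in> M \<and> (\<forall>z\<in>M. cinner (x - y') z = 0)"
  then have "y' - y \<in> M"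
    using M y(1) by (intro closed_csubspace_ops) auto
  then have "cinner ((x - y) - (x - y')) (y' - y) = 0"
    using y y' by (simp add: cinner_diff_left)
  then show "y' = y"
    by simp
qed

lemma
  fixes x :: "'a::complex_hilbert_space"
  assumes M: "closed_csubspace M"
  shows orth_proj_in: "orth_proj M x \<in> M"
    and orth_proj_orth: "z \<in> M \<Longrightarrow> cinner (x - orth_proj M x) z = 0"
proof -
  obtain y where y: "y \<in> M" "\<And>z. z \<in> M \<Longrightarrow> cinner (x - y) z = 0"
    using orth_proj_exists[OF M] by blast
  then have "orth_proj M x = y"
    by (rule orth_proj_unique[OF M])
  then show "orth_proj M x \<in> M" "z \<in> M \<Longrightarrow> cinner (x - orth_proj M x) z = 0"
    using y by auto
qed

text \<open>A nonzero functional is determined by any vector orthogonal to its kernel, and the projection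
  onto the kernel produces such a vector.\<close>

lemma Riesz_representation:
  fixes f :: "'a::complex_hilbert_space \<Rightarrow> complex"
  assumes M: "closed_csubspace M"
    and add: "\<And>x y. x \<in> M \<Longrightarrow> y \<in> M \<Longrightarrow> f (x + y) = f x + f y"
    and scale: "\<And>c x. x \<in> M \<Longrightarrow> f (c *\<^sub>C x) = c * f x"
    and bound: "\<And>x. x \<in> M \<Longrightarrow> cmod (f x) \<le> K * norm x"
  shows "\<exists>g\<in>M. \<forall>x\<in>M. f x = cinner x g"
proof (cases "\<forall>x\<in>M. f x = 0")
  case True
  then show ?thesis
    using closed_csubspace_ops(1)[OF M] by (intro bexI[of _ 0]) auto
next
  case False
  then obtain x0 where x0: "x0 \<in> M" "f x0 \<noteq> 0"
    by blast
  define Z where "Z = {x\<in>M. f x = 0}"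
  have diff: "f (x - y) = f x - f y" if "x \<in> M" "y \<in> M" for x y
    using add[OF closed_csubspace_ops(3)[OF M that] that(2)] by simp
  have cont: "continuous_on M f"
  proof (rule continuous_onI)
    fix x e assume x: "x \<in> M" and e: "(0::real) < e"
    have "dist (f y) (f x) < e" if "y \<in> M" "dist y x < e / (\<bar>K\<bar> + 1)" for y
    proof -
      have "dist (f y) (f x) \<le> K * norm (y - x)"
        using bound[OF closed_csubspace_ops(3)[OF M that(1) x]] diff[OF that(1) x]
        by (simp add: dist_norm)
      also have "\<dots> \<le> (\<bar>K\<bar> + 1) * norm (y - x)"
        by (intro mult_right_mono) auto
      also have "\<dots> < e"
        using that(2) by (simp add: dist_norm field_simps)
      finally show ?thesis .
    qed
    then show "\<exists>d>0. \<forall>y\<in>M. dist y x < d \<longrightarrow> dist (f y) (f x) \<le> e"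
      using e by (intro exI[of _ "e / (\<bar>K\<bar> + 1)"]) (auto simp: less_imp_le)
  qed
  have "closed (M \<inter> f -` {0})"
    using M cont by (intro continuous_closed_preimage) (auto simp: closed_csubspace_def)
  moreover have "M \<inter> f -` {0} = Z"
    by (auto simp: Z_def)
  moreover have "scaleC.subspace Z"
    unfolding Z_def using closed_csubspace_ops[OF M] add scale scale[of 0 0]
    by (intro scaleC.subspaceI) auto
  ultimately have Z: "closed_csubspace Z"
    by (simp add: closed_csubspace_def)
  define w where "w = x0 - orth_proj Z x0"
  have p: "orth_proj Z x0 \<in> M" "f (orth_proj Z x0) = 0"
    using orth_proj_in[OF Z, of x0] by (auto simp: Z_def)
  have wM: "w \<in> M"
    unfolding w_def by (intro closed_csubspace_ops[OF M] x0 p)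
  have fw: "f w \<noteq> 0"
    using x0 p by (simp add: w_def diff)
  have w: "w \<noteq> 0"
    using fw scale[OF wM, of 0] by auto
  define g where "g = (cnj (f w) / complex_of_real ((norm w)\<^sup>2)) *\<^sub>C w"
  have "f x = cinner x g" if x: "x \<in> M" for x
  proof -
    define u where "u = x - (f x / f w) *\<^sub>C w"
    have "u \<in> Z"
      using x wM fw closed_csubspace_ops[OF M] by (auto simp: u_def Z_def diff scale)
    then have "cinner w u = 0"
      unfolding w_def by (rule orth_proj_orth[OF Z])
    then have "cinner u w = 0"
      by (simp add: cinner_eq_0_commute)
    then have "cinner x w = (f x / f w) * complex_of_real ((norm w)\<^sup>2)"
      by (simp add: u_def cinner_diff_left cinner_scaleC_left cinner_self)
    then show ?thesis
      using fw w by (simp add: g_def cinner_scaleC_right)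
  qed
  moreover have "g \<in> M"
    unfolding g_def by (rule closed_csubspace_ops(4)[OF M wM])
  ultimately show ?thesis
    by blast
qed

section \<open>Bounded operators between closed subspaces\<close>

lemma bounded_op_on_bound:
  assumes "bounded_op_on M N F"
  obtains K where "K \<ge> 0" "\<And>x. x \<in> M \<Longrightarrow> norm (F x) \<le> K * norm x"
proof -
  obtain K where K: "\<forall>x\<in>M. norm (F x) \<le> K * norm x"
    using assms by (auto simp: bounded_op_on_def)
  have "norm (F x) \<le> \<bar>K\<bar> * norm x" if "x \<in> M" for x
    using K that by (meson abs_ge_self mult_right_mono norm_ge_zero order_trans)
  then show thesis
    using that[of "\<bar>K\<bar>"] by simp
qed

lemma
  assumes "bounded_op_on M N F"
  shows bounded_op_on_in: "x \<in> M \<Longrightarrow> F x \<in> N"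
    and bounded_op_on_add: "x \<in> M \<Longrightarrow> y \<in> M \<Longrightarrow> F (x + y) = F x + F y"
    and bounded_op_on_scaleC: "x \<in> M \<Longrightarrow> F (c *\<^sub>C x) = c *\<^sub>C F x"
  using assms by (auto simp: bounded_op_on_def)

lemma bounded_op_on_mono: "bounded_op_on M N F \<Longrightarrow> N \<subseteq> N' \<Longrightarrow> bounded_op_on M N' F"
  by (auto simp: bounded_op_on_def)

lemma bounded_op_on_cong:
  assumes "closed_csubspace M" "bounded_op_on M N F" "\<And>x. x \<in> M \<Longrightarrow> G x = F x"
  shows "bounded_op_on M N G"
  using assms closed_csubspace_ops[OF assms(1)] by (simp add: bounded_op_on_def)

lemma bounded_op_on_id: "bounded_op_on M M id"
  by (auto simp: bounded_op_on_def intro: exI[of _ 1])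

lemma bounded_op_on_zero: "0 \<in> N \<Longrightarrow> bounded_op_on M N (\<lambda>_. 0)"
  by (auto simp: bounded_op_on_def intro: exI[of _ 0])

lemma bounded_op_on_comp:
  assumes F: "bounded_op_on M N F" and G: "bounded_op_on L M G"
  shows "bounded_op_on L N (F \<circ> G)"
proof -
  obtain K where K: "K \<ge> 0" "\<And>x. x \<in> M \<Longrightarrow> norm (F x) \<le> K * norm x"
    using bounded_op_on_bound[OF F] by blast
  obtain J where J: "\<And>x. x \<in> L \<Longrightarrow> norm (G x) \<le> J * norm x"
    using bounded_op_on_bound[OF G] by blast
  have "norm (F (G x)) \<le> (K * J) * norm x" if "x \<in> L" for x
    using K(2)[OF bounded_op_on_in[OF G that]] mult_left_mono[OF J[OF that] K(1)]
    by (simp add: mult.assoc)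
  then have "\<exists>K. \<forall>x\<in>L. norm ((F \<circ> G) x) \<le> K * norm x"
    by (intro exI[of _ "K * J"]) simp
  then show ?thesis
    using F G unfolding bounded_op_on_def by simp
qed

lemma bounded_op_on_plus:
  assumes F: "bounded_op_on M UNIV F" and G: "bounded_op_on M UNIV G"
  shows "bounded_op_on M UNIV (\<lambda>x. F x + G x)"
proof -
  obtain K where K: "\<And>x. x \<in> M \<Longrightarrow> norm (F x) \<le> K * norm x"
    using bounded_op_on_bound[OF F] by blast
  obtain J where J: "\<And>x. x \<in> M \<Longrightarrow> norm (G x) \<le> J * norm x"
    using bounded_op_on_bound[OF G] by blast
  have "norm (F x + G x) \<le> (K + J) * norm x" if "x \<in> M" for x
    using K[OF that] J[OF that] norm_triangle_ineq[of "F x" "G x"] by (simp add: distrib_right)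
  then show ?thesis
    using F G by (auto simp: bounded_op_on_def scaleC_add_right)
qed

lemma bounded_op_on_scaleR:
  assumes F: "bounded_op_on M UNIV F"
  shows "bounded_op_on M UNIV (\<lambda>x. r *\<^sub>R F x)"
proof -
  obtain K where K: "\<And>x. x \<in> M \<Longrightarrow> norm (F x) \<le> K * norm x"
    using bounded_op_on_bound[OF F] by blast
  have "norm (r *\<^sub>R F x) \<le> (\<bar>r\<bar> * K) * norm x" if "x \<in> M" for x
    using mult_left_mono[OF K[OF that], of "\<bar>r\<bar>"] by (simp add: mult.assoc)
  then have "\<exists>K. \<forall>x\<in>M. norm (r *\<^sub>R F x) \<le> K * norm x"
    by blast
  moreover have "r *\<^sub>R F (c *\<^sub>C x) = c *\<^sub>C r *\<^sub>R F x" if "x \<in> M" for c x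
    using bounded_op_on_scaleC[OF F that] by (simp add: scaleR_scaleC scaleC_scaleC mult.commute)
  ultimately show ?thesis
    using F by (simp add: bounded_op_on_def scaleR_add_right)
qed

lemma bounded_op_on_sum:
  assumes "\<And>i. i \<in> I \<Longrightarrow> bounded_op_on M UNIV (F i)"
  shows "bounded_op_on M UNIV (\<lambda>x. \<Sum>i\<in>I. F i x)"
  using assms
proof (induction I rule: infinite_finite_induct)
  case (insert i I)
  then show ?case
    using bounded_op_on_plus[of M "F i" "\<lambda>x. \<Sum>i\<in>I. F i x"] by simp
qed (simp_all add: bounded_op_on_zero)

lemma bounded_op_funpow: "bounded_op F \<Longrightarrow> bounded_op (F ^^ j)"
proof (induction j)
  case 0
  then show ?case
    using bounded_op_on_id[of UNIV] by (simp add: id_def)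
next
  case (Suc j)
  then show ?case
    using bounded_op_on_comp[of UNIV UNIV F UNIV "F ^^ j"] by (simp add: comp_def)
qed

lemma bounded_linear_bounded_op:
  assumes "bounded_op F"
  shows "bounded_linear F"
proof -
  obtain K where "\<And>x. norm (F x) \<le> K * norm x"
    using bounded_op_on_bound[OF assms] by auto
  then show ?thesis
    using assms
    by (intro bounded_linear_intro[where K = K])
       (auto simp: bounded_op_on_def scaleR_scaleC mult.commute)
qed

lemma orth_proj_ident: "closed_csubspace M \<Longrightarrow> x \<in> M \<Longrightarrow> orth_proj M x = x"
  by (rule orth_proj_unique) auto

lemma orth_proj_norm_le:
  fixes x :: "'a::complex_hilbert_space"
  assumes M: "closed_csubspace M"
  shows "norm (orth_proj M x) \<le> norm x"
proof -
  have "(norm x)\<^sup>2 = (norm (x - orth_proj M x))\<^sup>2 + (norm (orth_proj M x))\<^sup>2"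
    using norm_add_sq[of "x - orth_proj M x" "orth_proj M x"]
      orth_proj_orth[OF M orth_proj_in[OF M], of x x] by simp
  then show ?thesis
    by (simp add: power2_le_imp_le)
qed

lemma bounded_op_on_orth_proj:
  fixes M :: "'a::complex_hilbert_space set"
  assumes M: "closed_csubspace M"
  shows "bounded_op_on UNIV M (orth_proj M)"
proof -
  note P = orth_proj_in[OF M] orth_proj_orth[OF M]
  have "orth_proj M (x + y) = orth_proj M x + orth_proj M y" for x y
  proof (rule orth_proj_unique[OF M])
    show "orth_proj M x + orth_proj M y \<in> M"
      by (intro closed_csubspace_ops[OF M] P)
    show "cinner (x + y - (orth_proj M x + orth_proj M y)) z = 0" if "z \<in> M" for z
      using P(2)[OF that, of x] P(2)[OF that, of y]
      by (simp add: cinner_add_left cinner_diff_left algebra_simps)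
  qed
  moreover have "orth_proj M (c *\<^sub>C x) = c *\<^sub>C orth_proj M x" for c x
  proof (rule orth_proj_unique[OF M])
    show "c *\<^sub>C orth_proj M x \<in> M"
      by (intro closed_csubspace_ops[OF M] P)
    show "cinner (c *\<^sub>C x - c *\<^sub>C orth_proj M x) z = 0" if "z \<in> M" for z
      using P(2)[OF that, of x] by (simp add: cinner_scaleC_left cinner_diff_left)
  qed
  moreover have "norm (orth_proj M x) \<le> 1 * norm x" for x
    using orth_proj_norm_le[OF M] by simp
  ultimately show ?thesis
    using P(1) unfolding bounded_op_on_def by blast
qed

lemma
  fixes F :: "'a::complex_hilbert_space \<Rightarrow> 'a"
  assumes M: "closed_csubspace M" and F: "bounded_op_on M N F"
  shows adjoint_on_in: "y \<in> N \<Longrightarrow> adjoint_on M N F y \<in> M"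
    and cinner_adjoint_on: "x \<in> M \<Longrightarrow> y \<in> N \<Longrightarrow> cinner (F x) y = cinner x (adjoint_on M N F y)"
proof -
  obtain K where K: "\<And>x. x \<in> M \<Longrightarrow> norm (F x) \<le> K * norm x"
    using bounded_op_on_bound[OF F] by blast
  have "\<exists>g\<in>M. \<forall>x\<in>M. cinner (F x) y = cinner x g" for y
  proof (rule Riesz_representation[OF M])
    show "cmod (cinner (F x) y) \<le> (K * norm y) * norm x" if "x \<in> M" for x
      using cinner_Cauchy_Schwarz[of "F x" y] mult_right_mono[OF K[OF that], of "norm y"]
      by (simp add: mult_ac)
  qed (use F in \<open>auto simp: bounded_op_on_def cinner_add_left cinner_scaleC_left\<close>)
  then obtain G where "\<And>y. G y \<in> M" "\<And>x y. x \<in> M \<Longrightarrow> cinner (F x) y = cinner x (G y)"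
    by metis
  then have "\<exists>G. (\<forall>y\<in>N. G y \<in> M) \<and> (\<forall>x\<in>M. \<forall>y\<in>N. cinner (F x) y = cinner x (G y))"
    by blast
  note spec = someI_ex[OF this, folded adjoint_on_def]
  show "y \<in> N \<Longrightarrow> adjoint_on M N F y \<in> M"
    using spec by blast
  show "x \<in> M \<Longrightarrow> y \<in> N \<Longrightarrow> cinner (F x) y = cinner x (adjoint_on M N F y)"
    using spec by blast
qed

lemma cinner_adjoint_on_left:
  fixes F :: "'a::complex_hilbert_space \<Rightarrow> 'a"
  assumes "closed_csubspace M" "bounded_op_on M N F" "x \<in> M" "y \<in> N"
  shows "cinner (adjoint_on M N F y) x = cinner y (F x)"
  using cinner_adjoint_on[OF assms] by (metis cinner_commute)

lemma cinner_ext: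
  fixes u :: "'a::complex_inner"
  assumes "closed_csubspace M" "u \<in> M" "v \<in> M" "\<And>x. x \<in> M \<Longrightarrow> cinner x u = cinner x v"
  shows "u = v"
  using assms(4)[OF closed_csubspace_ops(3)[OF assms(1-3)]]
  by (metis cinner_diff_right cinner_self_eq_0 eq_iff_diff_eq_0)

lemma bounded_op_on_adjoint:
  fixes F :: "'a::complex_hilbert_space \<Rightarrow> 'a"
  assumes M: "closed_csubspace M" and N: "closed_csubspace N" and F: "bounded_op_on M N F"
  shows "bounded_op_on N M (adjoint_on M N F)"
proof -
  let ?G = "adjoint_on M N F"
  note in_M = adjoint_on_in[OF M F] and adj = cinner_adjoint_on[OF M F, symmetric]
  obtain K where K: "K \<ge> 0" "\<And>x. x \<in> M \<Longrightarrow> norm (F x) \<le> K * norm x"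
    using bounded_op_on_bound[OF F] by blast
  note opsM = closed_csubspace_ops[OF M] and opsN = closed_csubspace_ops[OF N]
  have "?G (x + y) = ?G x + ?G y" if xy: "x \<in> N" "y \<in> N" for x y
  proof (rule cinner_ext[OF M in_M[OF opsN(2)[OF xy]] opsM(2)[OF in_M in_M]])
    show "cinner z (?G (x + y)) = cinner z (?G x + ?G y)" if "z \<in> M" for z
      using that xy by (simp add: adj opsN(2) cinner_add_right)
  qed (fact xy)+
  moreover have "?G (c *\<^sub>C x) = c *\<^sub>C ?G x" if x: "x \<in> N" for x c
  proof (rule cinner_ext[OF M in_M[OF opsN(4)[OF x]] opsM(4)[OF in_M]])
    show "cinner z (?G (c *\<^sub>C x)) = cinner z (c *\<^sub>C ?G x)" if "z \<in> M" for z
      using that x by (simp add: adj opsN(4) cinner_scaleC_right)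
  qed (fact x)
  moreover have "norm (?G y) \<le> K * norm y" if y: "y \<in> N" for y
  proof (cases "?G y = 0")
    case False
    have "(norm (?G y))\<^sup>2 = cmod (cinner (F (?G y)) y)"
      by (simp add: adj[symmetric] in_M y cinner_adjoint_on[OF M F] cinner_self norm_power)
    also have "\<dots> \<le> norm (F (?G y)) * norm y"
      by (rule cinner_Cauchy_Schwarz)
    also have "\<dots> \<le> K * norm (?G y) * norm y"
      by (intro mult_right_mono K in_M y) auto
    finally show ?thesis
      using False by (simp add: power2_eq_square mult_ac)
  qed (use K in auto)
  ultimately show ?thesis
    using in_M unfolding bounded_op_on_def by blast
qed

lemma cinner_funpow_cadjoint:
  fixes T :: "'a::complex_hilbert_space \<Rightarrow> 'a"
  assumes T: "bounded_op T"
  shows "cinner ((T ^^ j) x) y = cinner x ((cadjoint T ^^ j) y)"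
proof (induction j arbitrary: y)
  case (Suc j)
  have "cinner ((T ^^ Suc j) x) y = cinner ((T ^^ j) x) (cadjoint T y)"
    by (simp add: cinner_adjoint_on[OF closed_csubspace_UNIV T])
  then show ?case
    by (simp add: Suc funpow_swap1)
qed simp

text \<open>Moving the powers of \<open>S\<^sup>*\<close> to the other side of the inner product turns expansivity into a
  family of scalar inequalities for the quadratic form of \<open>Y\<close>.\<close>

lemma expansive_iff_form:
  fixes S Y :: "'a::complex_hilbert_space \<Rightarrow> 'a"
  assumes S: "bounded_op S" and Y: "bounded_op Y"
    and q: "\<And>x. cinner (Y x) x = complex_of_real (q x)"
  shows "expansive m Y S \<longleftrightarrow> (\<forall>x. (\<Sum>j=0..m. (-1) ^ j * real (m choose j) * q ((S ^^ j) x)) \<le> 0)"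
proof -
  let ?E = "\<lambda>x. \<Sum>j=0..m. ((-1) ^ j * real (m choose j)) *\<^sub>R (cadjoint S ^^ j) (Y ((S ^^ j) x))"
  have "bounded_op (\<lambda>x. (cadjoint S ^^ j) (Y ((S ^^ j) x)))" for j
    using bounded_op_on_comp[OF bounded_op_on_comp[OF
        bounded_op_funpow[OF bounded_op_on_adjoint[OF closed_csubspace_UNIV closed_csubspace_UNIV S]] Y]
        bounded_op_funpow[OF S], of j j]
    by (simp add: comp_def)
  then have "bounded_op (\<lambda>x. (- 1) *\<^sub>R ?E x)"
    by (intro bounded_op_on_scaleR bounded_op_on_sum)
  then have bd: "bounded_op (\<lambda>x. 0 - ?E x)"
    by simp
  have "cinner ((cadjoint S ^^ j) (Y ((S ^^ j) x))) x = complex_of_real (q ((S ^^ j) x))" for j x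
  proof -
    have "cinner ((cadjoint S ^^ j) (Y ((S ^^ j) x))) x = cnj (cinner ((S ^^ j) x) (Y ((S ^^ j) x)))"
      by (subst cinner_commute) (simp add: cinner_funpow_cadjoint[OF S])
    also have "\<dots> = cinner (Y ((S ^^ j) x)) ((S ^^ j) x)"
      by (rule cinner_commute[symmetric])
    finally show ?thesis
      by (simp add: q)
  qed
  then have "cinner (0 - ?E x) x =
      complex_of_real (- (\<Sum>j=0..m. (-1) ^ j * real (m choose j) * q ((S ^^ j) x)))" for x
    by (simp add: cinner_minus_left cinner_sum_left cinner_scaleR_left)
  then have "(cinner (0 - ?E x) x \<in> \<real>\<^sub>\<ge>\<^sub>0) \<longleftrightarrow>
      (\<Sum>j=0..m. (-1) ^ j * real (m choose j) * q ((S ^^ j) x)) \<le> 0" for x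
    by (simp only: complex_nonneg_Reals_iff) (simp del: of_real_minus of_real_sum of_real_mult)
  then show ?thesis
    using bd S Y by (simp add: expansive_def op_le_def positive_on_def)
qed

section \<open>Positive operators\<close>

text \<open>Polarisation: the form is real at \<open>x + y\<close> and at \<open>x + \<i> y\<close>, which equates the imaginary parts and
  the real parts of \<open>\<langle>F x, y\<rangle>\<close> and \<open>\<langle>x, F y\<rangle>\<close>.\<close>

lemma positive_on_selfadjoint:
  assumes M: "closed_csubspace M" and F: "positive_on M F" and x: "x \<in> M" and y: "y \<in> M"
  shows "cinner (F x) y = cinner x (F y)"
proof -
  have Im0: "Im (cinner (F u) u) = 0" if "u \<in> M" for u
    using F that by (auto simp: positive_on_def complex_nonneg_Reals_iff)
  have F': "bounded_op_on M M F"
    using F by (simp add: positive_on_def)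
  note ops = closed_csubspace_ops[OF M]
  have "Im (cinner (F x) y) = - Im (cinner (F y) x)"
    using Im0[OF ops(2)[OF x y]] Im0[OF x] Im0[OF y] bounded_op_on_add[OF F' x y]
    by (simp add: cinner_add_left cinner_add_right)
  moreover have "Re (cinner (F x) y) = Re (cinner (F y) x)"
    using Im0[OF ops(2)[OF x ops(4)[OF y, of \<i>]]] Im0[OF x] Im0[OF y]
      bounded_op_on_add[OF F' x ops(4)[OF y, of \<i>]] bounded_op_on_scaleC[OF F' y, of \<i>]
    by (simp add: cinner_add_left cinner_add_right cinner_scaleC_left cinner_scaleC_right)
  ultimately have "cinner (F x) y = cnj (cinner (F y) x)"
    by (simp add: complex_eq_iff)
  then show ?thesis
    by (simp add: cinner_commute[of x])
qed

text \<open>A lower bound makes the range closed; a vector orthogonal to the range is annihilated by the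
  self-adjoint operator and hence vanishes.\<close>

lemma selfadjoint_bounded_below_surj:
  fixes F :: "'a::complex_hilbert_space \<Rightarrow> 'a"
  assumes M: "closed_csubspace M" and F: "bounded_op_on M M F"
    and selfadj: "\<And>x y. x \<in> M \<Longrightarrow> y \<in> M \<Longrightarrow> cinner (F x) y = cinner x (F y)"
    and below: "\<And>x. x \<in> M \<Longrightarrow> norm x \<le> K * norm (F x)"
  shows "F ` M = M"
proof -
  have FP: "bounded_linear (F \<circ> orth_proj M)"
    using bounded_op_on_comp[OF F bounded_op_on_orth_proj[OF M]]
    by (intro bounded_linear_bounded_op) (rule bounded_op_on_mono, auto)
  have image: "(F \<circ> orth_proj M) ` M = F ` M"
    by (auto simp: orth_proj_ident[OF M])
  have "norm (F x) \<ge> inverse (\<bar>K\<bar> + 1) * norm x" if "x \<in> M" for x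
  proof -
    have "norm x \<le> (\<bar>K\<bar> + 1) * norm (F x)"
      using below[OF that] by (rule order_trans) (auto intro: mult_right_mono)
    then show ?thesis
      by (simp add: field_simps)
  qed
  moreover have "subspace M"
    using closed_csubspace_ops[OF M] closed_csubspace_scaleR[OF M] by (auto simp: subspace_def)
  ultimately have "complete ((F \<circ> orth_proj M) ` M)"
    using M
    by (intro complete_isometric_image[OF _ _ FP, of "inverse (\<bar>K\<bar> + 1)"])
       (auto simp: orth_proj_ident[OF M] complete_eq_closed closed_csubspace_def)
  then have "closed (F ` M)"
    unfolding image by (rule complete_imp_closed)
  moreover have "scaleC.subspace (F ` M)"
  proof (rule scaleC.subspaceI)
    have "F 0 = 0"
      using bounded_op_on_scaleC[OF F closed_csubspace_ops(1)[OF M], of 0] by simp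
    then show "0 \<in> F ` M"
      using closed_csubspace_ops(1)[OF M] by (metis imageI)
    show "x + y \<in> F ` M" if xy: "x \<in> F ` M" "y \<in> F ` M" for x y
    proof -
      obtain u v where "u \<in> M" "v \<in> M" "x = F u" "y = F v"
        using xy by blast
      then show ?thesis
        using closed_csubspace_ops(2)[OF M, of u v]
        by (intro image_eqI[of _ _ "u + v"]) (simp_all add: bounded_op_on_add[OF F])
    qed
    show "c *\<^sub>C x \<in> F ` M" if x: "x \<in> F ` M" for c x
    proof -
      obtain u where "u \<in> M" "x = F u"
        using x by blast
      then show ?thesis
        using closed_csubspace_ops(4)[OF M, of u c]
        by (intro image_eqI[of _ _ "c *\<^sub>C u"]) (simp_all add: bounded_op_on_scaleC[OF F])
    qed
  qed
  ultimately have Z: "closed_csubspace (F ` M)"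
    by (simp add: closed_csubspace_def)
  have sub: "F ` M \<subseteq> M"
    using bounded_op_on_in[OF F] by blast
  have "x \<in> F ` M" if x: "x \<in> M" for x
  proof -
    define w where "w = x - orth_proj (F ` M) x"
    have w: "w \<in> M"
      unfolding w_def using x sub orth_proj_in[OF Z] closed_csubspace_ops(3)[OF M] by blast
    then have "F (F w) \<in> F ` M"
      using sub by blast
    then have "cinner w (F (F w)) = 0"
      unfolding w_def by (rule orth_proj_orth[OF Z])
    then have "F w = 0"
      using selfadj[OF w bounded_op_on_in[OF F w]] by simp
    then have "w = 0"
      using below[OF w] by simp
    then show ?thesis
      using orth_proj_in[OF Z, of x] by (simp add: w_def)
  qed
  then show ?thesis
    using sub by blast
qed

section \<open>Powers of expansive operators\<close>

text \<open>For the sequence \<open>a k = \<langle>Y T\<^sup>k x, T\<^sup>k x\<rangle>\<close>, the \<open>m\<close>-th iterate of this difference with lag \<open>n\<close> is, at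
  \<open>k = 0\<close>, the sum whose sign decides whether \<open>T\<^sup>n\<close> is \<open>(m, Y)\<close>-expansive.\<close>

definition lag_diff :: "nat \<Rightarrow> (nat \<Rightarrow> real) \<Rightarrow> nat \<Rightarrow> real" where
  "lag_diff n a k = a k - a (k + n)"

lemma lag_diff_funpow:
  "(lag_diff n ^^ m) a k = (\<Sum>j=0..m. (-1) ^ j * real (m choose j) * a (k + n * j))"
proof (induction m arbitrary: k)
  case (Suc m)
  let ?S = "\<lambda>k. \<Sum>j\<le>m. (-1) ^ j * real (m choose j) * a (k + n * j)"
  have "(\<Sum>j\<le>Suc m. (-1) ^ j * real (Suc m choose j) * a (k + n * j)) =
      a k + (\<Sum>j\<le>m. (-1) ^ Suc j * real (Suc m choose Suc j) * a (k + n * Suc j))"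
    by (subst sum.atMost_Suc_shift) simp
  also have "\<dots> = (a k + (\<Sum>j\<le>m. (-1) ^ Suc j * real (m choose Suc j) * a (k + n * Suc j)))
      - ?S (k + n)"
    by (simp add: sum.distrib[symmetric] sum_subtractf[symmetric] sum_negf[symmetric] algebra_simps)
  also have "a k + (\<Sum>j\<le>m. (-1) ^ Suc j * real (m choose Suc j) * a (k + n * Suc j)) =
      (\<Sum>j\<le>Suc m. (-1) ^ j * real (m choose j) * a (k + n * j))"
    by (subst sum.atMost_Suc_shift) simp
  \<comment> \<open>the additional summand has the coefficient \<open>m choose Suc m = 0\<close>\<close>
  also have "\<dots> = ?S k"
    by simp
  finally have "?S k - ?S (k + n) =
      (\<Sum>j\<le>Suc m. (-1) ^ j * real (Suc m choose j) * a (k + n * j))"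
    by (rule sym)
  moreover have "(lag_diff n ^^ Suc m) a k = (lag_diff n ^^ m) a k - (lag_diff n ^^ m) a (k + n)"
    by (simp add: lag_diff_def[of n "(lag_diff n ^^ m) a" k])
  ultimately show ?case
    by (simp only: Suc atLeast0AtMost)
qed simp

text \<open>Telescoping writes the difference with lag \<open>n\<close> as a sum of \<open>n\<close> shifts of the difference with
  lag \<open>1\<close>; this is the factorisation \<open>1 - x\<^sup>n = (1 + x + \<dots> + x\<^sup>n\<^sup>-\<^sup>1) (1 - x)\<close> with \<open>x\<close> as the shift.\<close>

lemma lag_diff_telescope: "lag_diff n a k = (\<Sum>i<n. lag_diff 1 a (k + i))"
  by (induction n) (auto simp: lag_diff_def)

text \<open>The factor \<open>1 + x + \<dots> + x\<^sup>n\<^sup>-\<^sup>1\<close> commutes with differences and preserves nonpositivity, so each of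
  the \<open>m\<close> differences can be replaced in turn.\<close>

lemma lag_diff_nonpos:
  assumes "\<And>k. (lag_diff 1 ^^ m) a k \<le> 0"
  shows "(lag_diff n ^^ m) a k \<le> 0"
  using assms
proof (induction m arbitrary: a k)
  case (Suc m)
  have "(lag_diff 1 ^^ m) (lag_diff n a) l \<le> 0" for l
  proof -
    have "(lag_diff 1 ^^ m) (lag_diff n a) l = (\<Sum>i<n. (lag_diff 1 ^^ m) (lag_diff 1 a) (l + i))"
      unfolding lag_diff_funpow
      by (subst sum.swap) (simp add: lag_diff_telescope[of n a] sum_distrib_left add_ac)
    then show ?thesis
      using Suc.prems by (auto simp: funpow_swap1 intro!: sum_nonpos)
  qed
  then show ?case
    using Suc.IH[of "lag_diff n a"] by (simp add: funpow_swap1)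
qed simp

text \<open>The hypothesis holds at every vector \<open>T\<^sup>k x\<close>, so the \<open>m\<close>-th difference with lag \<open>1\<close> of the sequence
  \<open>\<parallel>T\<^sup>n T\<^sup>k x\<parallel>\<^sup>2\<close> is nonpositive everywhere; passing to lag \<open>n\<close> replaces \<open>T\<close> by \<open>T\<^sup>n\<close> but keeps the weight.\<close>

lemma expansive_power_form:
  fixes T :: "'a::complex_hilbert_space \<Rightarrow> 'a"
  assumes T: "bounded_op T" and exp: "expansive m ((cadjoint T ^^ n) \<circ> (T ^^ n)) T"
  shows "(\<Sum>j=0..m. (-1) ^ j * real (m choose j) * (norm ((T ^^ n) (((T ^^ n) ^^ j) x)))\<^sup>2) \<le> 0"
proof -
  have "cinner (((cadjoint T ^^ n) \<circ> (T ^^ n)) x) x = complex_of_real ((norm ((T ^^ n) x))\<^sup>2)" for x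
  proof -
    have "cinner (((cadjoint T ^^ n) \<circ> (T ^^ n)) x) x = cnj (cinner ((T ^^ n) x) ((T ^^ n) x))"
      by (subst cinner_commute) (simp add: cinner_funpow_cadjoint[OF T])
    then show ?thesis
      by (simp add: cinner_self)
  qed
  then have form: "(\<Sum>j=0..m. (-1) ^ j * real (m choose j) * (norm ((T ^^ n) ((T ^^ j) x)))\<^sup>2) \<le> 0" for x
    using exp expansive_iff_form[OF T, of "(cadjoint T ^^ n) \<circ> (T ^^ n)"
        "\<lambda>x. (norm ((T ^^ n) x))\<^sup>2" m]
    by (simp add: expansive_def)
  let ?a = "\<lambda>k. (norm ((T ^^ n) ((T ^^ k) x)))\<^sup>2"
  have "(lag_diff 1 ^^ m) ?a k \<le> 0" for k
    using form[of "(T ^^ k) x"] by (simp add: lag_diff_funpow funpow_add[symmetric, THEN fun_cong, unfolded comp_apply] add.commute)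
  then have "(lag_diff n ^^ m) ?a 0 \<le> 0"
    by (rule lag_diff_nonpos)
  then show ?thesis
    by (simp add: lag_diff_funpow funpow_mult)
qed

text \<open>In the inequality for \<open>W x\<close> the term with index \<open>0\<close> is the squared norm of \<open>W x\<close>, and all the
  other terms are bounded by multiples of the squared norm of \<open>W (W x)\<close>.\<close>

lemma expansive_form_bounded_below:
  fixes W :: "'a::complex_inner \<Rightarrow> 'a"
  assumes W: "bounded_op W"
    and exp: "\<And>x. (\<Sum>j=0..m. (-1) ^ j * real (m choose j) * (norm (W ((W ^^ j) x)))\<^sup>2) \<le> 0"
  shows "\<exists>K. \<forall>y \<in> closure (range W). norm y \<le> K * norm (W y)"
proof -
  have "\<exists>K. \<forall>y. norm ((W ^^ Suc j) y) \<le> K * norm (W y)" for j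
  proof -
    obtain K where "\<And>x. norm ((W ^^ j) x) \<le> K * norm x"
      using bounded_op_on_bound[OF bounded_op_funpow[OF W, of j]] by auto
    then show ?thesis
      by (metis comp_apply funpow_Suc_right)
  qed
  then obtain K where K: "\<And>j y. norm ((W ^^ Suc j) y) \<le> K j * norm (W y)"
    by metis
  define E where "E = (\<Sum>j<m. real (m choose Suc j) * (K j)\<^sup>2)"
  have E: "E \<ge> 0"
    by (auto simp: E_def intro: sum_nonneg)
  have range: "norm y \<le> sqrt E * norm (W y)" if y: "y \<in> range W" for y
  proof -
    obtain x where x: "y = W x"
      using y by blast
    let ?b = "\<lambda>j. (-1) ^ j * real (m choose j) * (norm ((W ^^ j) y))\<^sup>2"
    have "W ((W ^^ j) x) = (W ^^ j) y" for j
      by (simp add: x funpow_swap1)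
    then have "(\<Sum>j\<in>{0..m}. ?b j) \<le> 0"
      using exp[of x] by simp
    also have "{0..m} = {..<Suc m}"
      by auto
    finally have "(norm y)\<^sup>2 \<le> (\<Sum>j<m. - ?b (Suc j))"
      by (subst (asm) sum.lessThan_Suc_shift) (simp add: sum_negf)
    also have "\<dots> \<le> (\<Sum>j<m. real (m choose Suc j) * (K j * norm (W y))\<^sup>2)"
    proof (rule sum_mono)
      fix j
      have "- ?b (Suc j) \<le> \<bar>?b (Suc j)\<bar>"
        by simp
      also have "\<dots> = real (m choose Suc j) * (norm ((W ^^ Suc j) y))\<^sup>2"
        by (simp only: abs_mult power_abs abs_minus_cancel abs_one power_one abs_of_nat abs_norm_cancel mult_1)
      also have "\<dots> \<le> real (m choose Suc j) * (K j * norm (W y))\<^sup>2"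
        by (intro mult_left_mono power_mono K) auto
      finally show "- ?b (Suc j) \<le> real (m choose Suc j) * (K j * norm (W y))\<^sup>2" .
    qed
    also have "\<dots> = E * (norm (W y))\<^sup>2"
      by (simp only: E_def power_mult_distrib sum_distrib_right mult.assoc)
    also have "\<dots> = (sqrt E * norm (W y))\<^sup>2"
      using E by (simp add: power_mult_distrib)
    finally show ?thesis
      using E by (auto elim: power2_le_imp_le)
  qed
  have "continuous_on UNIV W"
    using bounded_linear_bounded_op[OF W] by (rule linear_continuous_on)
  then have "closed {y. norm y \<le> sqrt E * norm (W y)}"
    by (intro closed_Collect_le continuous_intros)
  then have "closure (range W) \<subseteq> {y. norm y \<le> sqrt E * norm (W y)}"
    by (intro closure_minimal) (use range in auto)
  then show ?thesis
    by blast
qed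

section \<open>Operator matrices\<close>

definition orth_compl :: "'a::complex_inner set \<Rightarrow> 'a set" where
  "orth_compl M = {z. \<forall>y\<in>M. cinner z y = 0}"

lemma cinner_orth_compl:
  assumes "y \<in> M" "z \<in> orth_compl M"
  shows "cinner z y = 0" "cinner y z = 0"
  using assms cinner_eq_0_commute[of y z] by (auto simp: orth_compl_def)

lemma closed_csubspace_orth_compl: "closed_csubspace (orth_compl M)"
  for M :: "'a::complex_inner set"
proof -
  have "closed (orth_compl M)"
    unfolding orth_compl_def Collect_ball_eq by (intro closed_INT ballI closed_cinner_eq_0)
  then show ?thesis
    by (auto simp: closed_csubspace_def orth_compl_def cinner_add_left cinner_scaleC_left
        intro!: scaleC.subspaceI)
qed

lemma orth_proj_orth_compl:
  fixes M :: "'a::complex_hilbert_space set"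
  assumes M: "closed_csubspace M"
  shows "orth_proj (orth_compl M) x = x - orth_proj M x"
proof (rule orth_proj_unique[OF closed_csubspace_orth_compl])
  show "x - orth_proj M x \<in> orth_compl M"
    by (simp add: orth_compl_def orth_proj_orth[OF M])
  show "cinner (x - (x - orth_proj M x)) z = 0" if "z \<in> orth_compl M" for z
    using cinner_orth_compl[OF orth_proj_in[OF M] that] by simp
qed

lemma
  fixes M :: "'a::complex_hilbert_space set"
  assumes M: "closed_csubspace M" and y: "y \<in> M" and z: "z \<in> orth_compl M"
  shows orth_proj_plus: "orth_proj M (y + z) = y"
    and orth_proj_orth_compl_plus: "orth_proj (orth_compl M) (y + z) = z"
proof -
  show "orth_proj M (y + z) = y"
    using y z by (intro orth_proj_unique[OF M]) (auto simp: orth_compl_def)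
  then show "orth_proj (orth_compl M) (y + z) = z"
    by (simp add: orth_proj_orth_compl[OF M])
qed

lemma bounded_op_block_op:
  fixes M N :: "'a::complex_hilbert_space set"
  assumes M: "closed_csubspace M" and N: "closed_csubspace N"
    and F: "bounded_op_on M M F11" "bounded_op_on N M F12" "bounded_op_on M N F21" "bounded_op_on N N F22"
  shows "bounded_op (block_op M N F11 F12 F21 F22)"
proof -
  have "bounded_op (F \<circ> orth_proj K)" if "closed_csubspace K" "bounded_op_on K L F"
    for K L :: "'a set" and F
    by (rule bounded_op_on_comp[OF bounded_op_on_mono[OF that(2) subset_UNIV]
          bounded_op_on_orth_proj[OF that(1)]])
  then have "bounded_op (\<lambda>x. ((F11 \<circ> orth_proj M) x + (F12 \<circ> orth_proj N) x)
      + ((F21 \<circ> orth_proj M) x + (F22 \<circ> orth_proj N) x))"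
    using M N F by (intro bounded_op_on_plus) blast+
  then show ?thesis
    by (simp add: block_op_def[abs_def])
qed

lemma cinner_block_op:
  fixes M :: "'a::complex_hilbert_space set"
  assumes M: "closed_csubspace M"
    and F11: "bounded_op_on M M F11" and F12: "bounded_op_on (orth_compl M) M F12"
    and F21: "bounded_op_on M (orth_compl M) F21" and F22: "bounded_op_on (orth_compl M) (orth_compl M) F22"
    and y: "y \<in> M" and z: "z \<in> orth_compl M"
  shows "cinner (block_op M (orth_compl M) F11 F12 F21 F22 (y + z)) (y + z) =
    cinner (F11 y) y + cinner (F12 z) y + cinner (F21 y) z + cinner (F22 z) z"
proof -
  have "cinner (F11 y) z = 0" "cinner (F12 z) z = 0" "cinner (F21 y) y = 0" "cinner (F22 z) y = 0"
    using bounded_op_on_in[OF F11 y] bounded_op_on_in[OF F12 z] bounded_op_on_in[OF F21 y]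
      bounded_op_on_in[OF F22 z] y z by (auto intro: cinner_orth_compl)
  then show ?thesis
    by (simp add: block_op_def orth_proj_plus[OF M y z] orth_proj_orth_compl_plus[OF M y z]
        cinner_add_left cinner_add_right)
qed

section \<open>Expansivity of operators similar to a given one\<close>

text \<open>The map \<open>R = G \<oplus> I\<close> is surjective and intertwines \<open>S\<close> with \<open>W\<close>, so \<open>S\<close> is similar to \<open>W\<close> when \<open>R\<close>
  is invertible. The matrix of \<open>Y\<close> is the product of the adjoint of the row \<open>(U L, X)\<close> with that row,
  and the row sends \<open>R x\<close> to \<open>W x\<close>. Hence the form of \<open>Y\<close> at \<open>S\<^sup>j (R x) = R (W\<^sup>j x)\<close> is
  \<open>\<parallel>W (W\<^sup>j x)\<parallel>\<^sup>2\<close>, and expansivity of \<open>W\<close> passes to \<open>S\<close>.\<close>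

lemma
  fixes W U G L K X Y S :: "'a::complex_hilbert_space \<Rightarrow> 'a" and M :: "'a set"
  defines "N \<equiv> orth_compl M"
  defines "Y \<equiv> block_op M N K (L \<circ> adjoint_on M M U \<circ> X) (adjoint_on N M X \<circ> U \<circ> L) (adjoint_on N M X \<circ> X)"
  defines "S \<equiv> block_op M N (G \<circ> U \<circ> L) (G \<circ> X) (\<lambda>_. 0) (\<lambda>_. 0)"
  assumes M: "closed_csubspace M"
    and W: "bounded_op_on UNIV M W" and X: "\<And>z. z \<in> N \<Longrightarrow> X z = W z"
    and U: "bounded_op_on M M U" and U_iso: "\<And>y. y \<in> M \<Longrightarrow> norm (U y) = norm y"
    and L: "bounded_op_on M M L"
    and L_selfadj: "\<And>x y. x \<in> M \<Longrightarrow> y \<in> M \<Longrightarrow> cinner (L x) y = cinner x (L y)"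
    and K: "bounded_op_on M M K" and K_sq: "\<And>y. y \<in> M \<Longrightarrow> K y = L (L y)"
  shows cinner_gram_block_op:
      "cinner (Y x) x = complex_of_real ((norm (U (L (orth_proj M x)) + W (orth_proj N x)))\<^sup>2)"
    and expansive_gram_block_op:
      "\<lbrakk>bounded_op_on M M G; G ` M = M; \<And>y. y \<in> M \<Longrightarrow> W y = U (L (G y));
        \<And>x. (\<Sum>j=0..m. (-1) ^ j * real (m choose j) * (norm (W ((W ^^ j) x)))\<^sup>2) \<le> 0\<rbrakk>
       \<Longrightarrow> expansive m Y S"
proof -
  let ?q = "\<lambda>x. (norm (U (L (orth_proj M x)) + W (orth_proj N x)))\<^sup>2"
  have N: "closed_csubspace N"
    unfolding N_def by (rule closed_csubspace_orth_compl)
  have PN: "orth_proj N x = x - orth_proj M x" for x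
    unfolding N_def by (rule orth_proj_orth_compl[OF M])
  note PM_in = orth_proj_in[OF M] and PN_in = orth_proj_in[OF N]
  have WN: "bounded_op_on N M W"
    using W by (auto simp: bounded_op_on_def)
  have X_bd: "bounded_op_on N M X"
    by (rule bounded_op_on_cong[OF N WN X])
  note U' = bounded_op_on_adjoint[OF M M U] and X' = bounded_op_on_adjoint[OF N M X_bd]
  have Y12: "bounded_op_on N M (L \<circ> adjoint_on M M U \<circ> X)"
    by (rule bounded_op_on_comp[OF bounded_op_on_comp[OF L U'] X_bd])
  have Y21: "bounded_op_on M N (adjoint_on N M X \<circ> U \<circ> L)"
    by (rule bounded_op_on_comp[OF bounded_op_on_comp[OF X' U] L])
  have Y22: "bounded_op_on N N (adjoint_on N M X \<circ> X)"
    by (rule bounded_op_on_comp[OF X' X_bd])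
  have Y: "bounded_op Y"
    unfolding Y_def by (rule bounded_op_block_op[OF M N K Y12 Y21 Y22])
  show form: "cinner (Y x) x = complex_of_real (?q x)" for x
  proof -
    define y z where "y = orth_proj M x" and "z = orth_proj N x"
    have x: "x = y + z"
      by (simp add: y_def z_def PN)
    have y: "y \<in> M" and z: "z \<in> N"
      by (simp_all add: y_def z_def PM_in PN_in)
    note in_M = bounded_op_on_in[OF L y] bounded_op_on_in[OF X_bd z]
    have "cinner (Y x) x = cinner (K y) y + cinner (L (adjoint_on M M U (X z))) y
        + cinner (adjoint_on N M X (U (L y))) z + cinner (adjoint_on N M X (X z)) z"
      using cinner_block_op[OF M K Y12[unfolded N_def] Y21[unfolded N_def] Y22[unfolded N_def] y z[unfolded N_def]]
      by (simp add: x Y_def N_def)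
    also have "cinner (K y) y = cinner (U (L y)) (U (L y))"
      using in_M y by (simp add: K_sq L_selfadj cinner_self U_iso)
    also have "cinner (L (adjoint_on M M U (X z))) y = cinner (X z) (U (L y))"
      using in_M y by (simp add: L_selfadj adjoint_on_in[OF M U] cinner_adjoint_on_left[OF M U])
    also have "cinner (adjoint_on N M X (U (L y))) z = cinner (U (L y)) (X z)"
      by (rule cinner_adjoint_on_left[OF N X_bd z bounded_op_on_in[OF U in_M(1)]])
    also have "cinner (adjoint_on N M X (X z)) z = cinner (X z) (X z)"
      by (rule cinner_adjoint_on_left[OF N X_bd z in_M(2)])
    finally have "cinner (Y x) x = cinner (U (L y) + X z) (U (L y) + X z)"
      by (simp add: cinner_add_left cinner_add_right add_ac)
    then show ?thesis
      by (simp add: cinner_self X[OF z] y_def[symmetric] z_def[symmetric])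
  qed
  assume G: "bounded_op_on M M G" and G_surj: "G ` M = M"
    and fact: "\<And>y. y \<in> M \<Longrightarrow> W y = U (L (G y))"
    and exp: "\<And>x. (\<Sum>j=0..m. (-1) ^ j * real (m choose j) * (norm (W ((W ^^ j) x)))\<^sup>2) \<le> 0"
  have S: "bounded_op S"
    unfolding S_def
    by (intro bounded_op_block_op[OF M N] bounded_op_on_comp[OF bounded_op_on_comp[OF G U] L]
        bounded_op_on_comp[OF G X_bd] bounded_op_on_zero closed_csubspace_ops(1)[OF M] closed_csubspace_ops(1)[OF N])
  \<comment> \<open>the operator \<open>G \<oplus> I\<close>\<close>
  define R where "R x = G (orth_proj M x) + orth_proj N x" for x
  have PM_R: "orth_proj M (R x) = G (orth_proj M x)" and PN_R: "orth_proj N (R x) = orth_proj N x" for x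
    using orth_proj_plus[OF M] orth_proj_orth_compl_plus[OF M] PM_in[of x] PN_in[of x]
      bounded_op_on_in[OF G] by (simp_all add: R_def N_def)
  have W_split: "W (orth_proj M x) + W (orth_proj N x) = W x" for x
    using bounded_op_on_add[OF W, of "orth_proj M x" "orth_proj N x"] by (simp add: PN)
  have W_in: "W x \<in> M" for x
    by (rule bounded_op_on_in[OF W UNIV_I])
  have SR: "S (R x) = R (W x)" for x
  proof -
    have "S (R x) = G (W (orth_proj M x)) + G (W (orth_proj N x))"
      by (simp add: S_def block_op_def PM_R PN_R fact[OF PM_in] X[OF PN_in])
    also have "\<dots> = G (W x)"
      by (simp add: bounded_op_on_add[OF G W_in W_in, symmetric] W_split)
    also have "\<dots> = R (W x)"
      by (simp add: R_def PN orth_proj_ident[OF M W_in])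
    finally show ?thesis .
  qed
  have SR_pow: "(S ^^ j) (R x) = R ((W ^^ j) x)" for j x
    by (induction j) (auto simp: SR)
  have q_R: "?q (R x) = (norm (W x))\<^sup>2" for x
    by (simp only: PM_R PN_R fact[OF PM_in, symmetric] W_split)
  have "(\<Sum>j=0..m. (-1) ^ j * real (m choose j) * ?q ((S ^^ j) v)) \<le> 0" for v
  proof -
    obtain y where y: "y \<in> M" "G y = orth_proj M v"
      using PM_in[of v] G_surj by (metis imageE)
    have "v = R (y + orth_proj N v)"
      using orth_proj_plus[OF M y(1)] orth_proj_orth_compl_plus[OF M y(1)] PN_in[of v] y(2)
      by (simp add: R_def N_def[symmetric] PN[of v])
    then obtain x where v: "v = R x"
      by blast
    show ?thesis
      unfolding v SR_pow q_R by (rule exp)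
  qed
  then show "expansive m Y S"
    unfolding expansive_iff_form[OF S Y form] by blast
qed

section \<open>Equivalent norms from operators bounded below\<close>

lemma
  fixes R :: "'a::complex_inner \<Rightarrow> 'a"
  assumes R: "bounded_op R" and below: "\<And>x. norm x \<le> K * norm (R x)"
  shows is_inner_product_pullback: "is_inner_product (\<lambda>x y. cinner (R x) (R y))"
    and equivalent_norm_pullback: "equivalent_norm (\<lambda>x. norm (R x))"
proof -
  note lin = bounded_op_on_add[OF R UNIV_I UNIV_I] bounded_op_on_scaleC[OF R UNIV_I]
  have R0: "R x = 0 \<longleftrightarrow> x = 0" for x
    using below[of x] lin(2)[of 0 0] by auto
  show "is_inner_product (\<lambda>x y. cinner (R x) (R y))"
    unfolding is_inner_product_def
  proof (intro conjI allI impI)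
    show "cinner (R x) (R y) = cnj (cinner (R y) (R x))" for x y
      by (rule cinner_commute)
  qed (auto simp: lin R0 cinner_add_left cinner_scaleC_left cinner_self simp del: of_real_power)
  obtain J where J: "J \<ge> 0" "\<And>x. norm (R x) \<le> J * norm x"
    using bounded_op_on_bound[OF R] by auto
  have "inverse (\<bar>K\<bar> + 1) * norm x \<le> norm (R x)" for x
  proof -
    have "norm x \<le> (\<bar>K\<bar> + 1) * norm (R x)"
      using below[of x] by (rule order_trans) (auto intro: mult_right_mono)
    then show ?thesis
      by (simp add: field_simps)
  qed
  moreover have "norm (R x) \<le> (J + 1) * norm x" for x
    using J(2)[of x] by (rule order_trans) (auto intro: mult_right_mono)
  ultimately have "\<exists>a b. a > 0 \<and> b > 0 \<and> (\<forall>x. a * norm x \<le> norm (R x) \<and> norm (R x) \<le> b * norm x)"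
    using J(1) by (intro exI[of _ "inverse (\<bar>K\<bar> + 1)"] exI[of _ "J + 1"]) auto
  moreover have "is_norm (\<lambda>x. norm (R x))"
    by (auto simp: is_norm_def lin R0 norm_scaleC norm_triangle_ineq)
  ultimately show "equivalent_norm (\<lambda>x. norm (R x))"
    by (simp add: equivalent_norm_def)
qed

section \<open>The range of a power and its orthogonal complement\<close>

lemma closed_csubspace_closure_range:
  fixes F :: "'a::complex_inner \<Rightarrow> 'a"
  assumes F: "bounded_op F"
  shows "closed_csubspace (closure (range F))"
proof -
  have zero: "F 0 = 0"
    using bounded_op_on_scaleC[OF F UNIV_I, of 0 0] by simp
  have "scaleC.subspace (closure (range F))"
  proof (rule scaleC.subspaceI)
    show "0 \<in> closure (range F)"
      by (metis zero closure_subset rangeI subsetD)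
    show "x + y \<in> closure (range F)" if "x \<in> closure (range F)" "y \<in> closure (range F)" for x y
    proof -
      obtain u v where u: "\<And>k. u k \<in> range F" "u \<longlonglongrightarrow> x" and v: "\<And>k. v k \<in> range F" "v \<longlonglongrightarrow> y"
        using \<open>x \<in> _\<close> \<open>y \<in> _\<close> unfolding closure_sequential by metis
      have "u k + v k \<in> range F" for k
        using u(1)[of k] v(1)[of k] bounded_op_on_add[OF F UNIV_I UNIV_I, symmetric] by auto
      moreover have "(\<lambda>k. u k + v k) \<longlonglongrightarrow> x + y"
        by (intro tendsto_add u v)
      ultimately show ?thesis
        unfolding closure_sequential by (intro exI[of _ "\<lambda>k. u k + v k"]) blast
    qed
    show "c *\<^sub>C x \<in> closure (range F)" if "x \<in> closure (range F)" for c x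
    proof -
      have "bounded_op (\<lambda>x :: 'a. c *\<^sub>C x)"
        by (auto simp: bounded_op_on_def scaleC_add_right scaleC_scaleC norm_scaleC mult.commute
            intro: exI[of _ "cmod c"])
      then have "(\<lambda>x. c *\<^sub>C x) ` closure (range F) \<subseteq> closure ((\<lambda>x. c *\<^sub>C x) ` range F)"
        by (intro closure_bounded_linear_image_subset bounded_linear_bounded_op)
      also have "\<dots> \<subseteq> closure (range F)"
        by (intro closure_mono) (auto simp: bounded_op_on_scaleC[OF F UNIV_I, symmetric])
      finally show ?thesis
        using that by blast
    qed
  qed
  then show ?thesis
    by (simp add: closed_csubspace_def)
qed

text \<open>The kernel of the adjoint is the orthogonal complement of the range, and orthogonality to a set
  extends to its closure.\<close>

lemma kernel_cadjoint_funpow: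
  fixes T :: "'a::complex_hilbert_space \<Rightarrow> 'a"
  assumes T: "bounded_op T"
  shows "{x. (cadjoint T ^^ n) x = 0} = orth_compl (closure (range (T ^^ n)))"
proof (intro equalityI subsetI)
  fix x assume "x \<in> {x. (cadjoint T ^^ n) x = 0}"
  then have "cinner ((T ^^ n) u) x = 0" for u
    by (simp add: cinner_funpow_cadjoint[OF T])
  then have "range (T ^^ n) \<subseteq> {y. cinner y x = 0}"
    by blast
  moreover have "closed {y. cinner y x = 0}"
    by (rule closed_cinner_eq_0)
  ultimately have "closure (range (T ^^ n)) \<subseteq> {y. cinner y x = 0}"
    by (rule closure_minimal)
  then have "cinner x y = 0" if "y \<in> closure (range (T ^^ n))" for y
    using that cinner_eq_0_commute[of x y] by auto
  then show "x \<in> orth_compl (closure (range (T ^^ n)))"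
    by (simp add: orth_compl_def)
next
  fix x assume x: "x \<in> orth_compl (closure (range (T ^^ n)))"
  have "(T ^^ n) ((cadjoint T ^^ n) x) \<in> closure (range (T ^^ n))"
    by (rule subsetD[OF closure_subset rangeI])
  then have "cinner ((T ^^ n) ((cadjoint T ^^ n) x)) x = 0"
    using x by (rule cinner_orth_compl)
  then show "x \<in> {x. (cadjoint T ^^ n) x = 0}"
    by (simp add: cinner_funpow_cadjoint[OF T])
qed

lemma funpow_restrict:
  assumes "\<And>x. x \<in> M \<Longrightarrow> T x \<in> M" "x \<in> M"
  shows "(restrict T M ^^ n) x = (T ^^ n) x" "(T ^^ n) x \<in> M"
  by (induction n) (use assms in auto)

lemma image_closure_range_funpow:
  fixes T :: "'a::complex_inner \<Rightarrow> 'a"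
  assumes T: "bounded_op T" and x: "x \<in> closure (range (T ^^ n))"
  shows "T x \<in> closure (range (T ^^ n))"
proof -
  have "T ` closure (range (T ^^ n)) \<subseteq> closure (T ` range (T ^^ n))"
    by (rule closure_bounded_linear_image_subset[OF bounded_linear_bounded_op[OF T]])
  also have "\<dots> \<subseteq> closure (range (T ^^ n))"
    by (intro closure_mono) (auto simp: funpow_swap1)
  finally show ?thesis
    using x by blast
qed

section \<open>Polar decomposition of an operator bounded below\<close>

text \<open>\<open>\<parallel>P x\<parallel>\<^sup>2 = \<langle>P\<^sup>2 x, x\<rangle> = \<langle>F\<^sup>* F x, x\<rangle> = \<parallel>F x\<parallel>\<^sup>2\<close>.\<close>

lemma norm_polar_positive_part:
  fixes F :: "'a::complex_hilbert_space \<Rightarrow> 'a"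
  assumes M: "closed_csubspace M" and F: "bounded_op_on M M F"
    and polar: "polar_decomposition_on M F U P" and x: "x \<in> M"
  shows "norm (P x) = norm (F x)"
proof -
  have P: "positive_on M P" and PP: "P (P x) = adjoint_on M M F (F x)"
    using polar x by (auto simp: polar_decomposition_on_def positive_sqrt_on_def)
  then have P_in: "P x \<in> M"
    using x bounded_op_on_in[of M M P x] by (simp add: positive_on_def)
  have "cinner (P x) (P x) = cinner (P (P x)) x"
    by (rule positive_on_selfadjoint[OF M P P_in x, symmetric])
  also have "\<dots> = cinner (F x) (F x)"
    unfolding PP by (rule cinner_adjoint_on_left[OF M F x bounded_op_on_in[OF F x]])
  finally have "(norm (P x))\<^sup>2 = (norm (F x))\<^sup>2"
    by (simp only: cinner_self of_real_eq_iff)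
  then show ?thesis
    by simp
qed

text \<open>The lower bound passes from \<open>F\<close> to \<open>P\<close>. So the common kernel of \<open>U\<close> and \<open>P\<close> is trivial, the initial
  space of the partial isometry \<open>U\<close> is all of \<open>M\<close>, and the positive operator \<open>P\<close> is invertible on
  \<open>M\<close>.\<close>

lemma polar_bounded_below:
  fixes F :: "'a::complex_hilbert_space \<Rightarrow> 'a"
  assumes M: "closed_csubspace M" and F: "bounded_op_on M M F"
    and polar: "polar_decomposition_on M F U P"
    and below: "\<And>x. x \<in> M \<Longrightarrow> norm x \<le> K * norm (F x)"
  shows "\<And>x. x \<in> M \<Longrightarrow> norm (U x) = norm x" "P ` M = M"
proof -
  have P: "positive_on M P"
    using polar by (simp add: polar_decomposition_on_def positive_sqrt_on_def)
  have below_P: "norm x \<le> K * norm (P x)" if "x \<in> M" for x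
    using below[OF that] by (simp add: norm_polar_positive_part[OF M F polar that])
  then have ker: "z = 0" if "z \<in> M" "U z = 0" for z
    using polar that by (fastforce simp: polar_decomposition_on_def)
  then show "norm (U x) = norm x" if "x \<in> M" for x
  proof -
    have "\<forall>z\<in>M. U z = 0 \<longrightarrow> cinner x z = 0"
      using ker by fastforce
    then show ?thesis
      using polar that unfolding polar_decomposition_on_def partial_isometry_on_def by blast
  qed
  show "P ` M = M"
    using P below_P positive_on_selfadjoint[OF M P]
    by (intro selfadjoint_bounded_below_surj[OF M]) (auto simp: positive_on_def)
qed

section \<open>Expansivity of the two transforms of \<open>T\<^sup>n\<close>\<close>

text \<open>The form of the matrix at \<open>y + z\<close>, with \<open>y\<close> in \<open>M\<close> and \<open>z\<close> in its complement, is
  \<open>\<parallel>y + X z\<parallel>\<^sup>2\<close>. It vanishes for \<open>y = - X z\<close>, whereas the form of the identity is \<open>\<parallel>y\<parallel>\<^sup>2 + \<parallel>z\<parallel>\<^sup>2\<close>.\<close>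

lemma gram_block_op_ge_id_trivial:
  fixes M :: "'a::complex_hilbert_space set"
  defines "N \<equiv> orth_compl M"
  assumes M: "closed_csubspace M" and X: "bounded_op_on N M X"
    and ge: "op_le id (block_op M N id X (adjoint_on N M X) (adjoint_on N M X \<circ> X))"
    and z: "z \<in> N"
  shows "z = 0"
proof -
  have N: "closed_csubspace N"
    unfolding N_def by (rule closed_csubspace_orth_compl)
  note X' = bounded_op_on_adjoint[OF N M X]
  let ?B = "block_op M N id X (adjoint_on N M X) (adjoint_on N M X \<circ> X)"
  define y where "y = - X z"
  have Xz: "X z \<in> M"
    by (rule bounded_op_on_in[OF X z])
  then have y: "y \<in> M"
    unfolding y_def by (rule closed_csubspace_ops(5)[OF M])
  have "cinner (?B (y + z)) (y + z) =
      cinner y y + cinner (X z) y + cinner (adjoint_on N M X y) z + cinner (adjoint_on N M X (X z)) z"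
    using cinner_block_op[OF M bounded_op_on_id X[unfolded N_def] X'[unfolded N_def]
        bounded_op_on_comp[OF X' X, unfolded N_def] y z[unfolded N_def]]
    by (simp add: N_def)
  also have "\<dots> = 0"
    by (simp add: cinner_adjoint_on_left[OF N X z] y Xz)
       (simp add: y_def cinner_minus_left cinner_minus_right)
  finally have "cinner (?B (y + z) - id (y + z)) (y + z) = - complex_of_real ((norm (y + z))\<^sup>2)"
    by (simp add: cinner_diff_left cinner_self)
  then have "y + z = 0"
    using ge unfolding op_le_def positive_on_def
    by (metis (no_types, lifting) UNIV_I Re_complex_of_real complex_nonneg_Reals_iff neg_0_le_iff_le
        norm_eq_zero of_real_minus power2_less_0 power_eq_0_iff zero_le_power2 antisym)
  then show "z = 0"
    using orth_proj_orth_compl_plus[OF M y z[unfolded N_def]]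
      orth_proj_ident[OF closed_csubspace_orth_compl, of 0 M] closed_csubspace_ops(1)[OF N]
    by (simp add: N_def)
qed

theorem theorem3p2:
  fixes T T1 X U1 P1 S1 A B C D Q :: "'a::complex_hilbert_space \<Rightarrow> 'a"
    and M N :: "'a set" and m n :: nat
  assumes "infinite_dimensional TYPE('a)"
    and "separable_space (euclidean :: 'a topology)"
    and "m \<ge> 1" and "n \<ge> 1"
    and "bounded_op T"
    and "expansive m ((cadjoint T ^^ n) \<circ> (T ^^ n)) T"
    and "M = closure (range (T ^^ n))"
    and "N = {x. (cadjoint T ^^ n) x = 0}"
    and "T1 = restrict T M"
    and "X = restrict (T ^^ n) N"
    and "polar_decomposition_on M (T1 ^^ n) U1 P1"
    and "positive_sqrt_on M P1 S1"
    and "A = block_op M N (S1 \<circ> U1 \<circ> S1) (S1 \<circ> X) (\<lambda>_. 0) (\<lambda>_. 0)"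
    and "B = block_op M N (P1 \<circ> U1) (P1 \<circ> X) (\<lambda>_. 0) (\<lambda>_. 0)"
    and "C = block_op M N P1 (S1 \<circ> adjoint_on M M U1 \<circ> X)
                          (adjoint_on N M X \<circ> U1 \<circ> S1) (adjoint_on N M X \<circ> X)"
    and "D = block_op M N id (adjoint_on M M U1 \<circ> X)
                          (adjoint_on N M X \<circ> U1) (adjoint_on N M X \<circ> X)"
    and "Q = block_op M N P1 (\<lambda>_. 0) (\<lambda>_. 0) id"
  shows "expansive m C A \<and> expansive m D B \<and>
    (op_le id (block_op M N id X (adjoint_on N M X) (adjoint_on N M X \<circ> X)) \<longrightarrow>
       expansive m id B \<and>
       is_inner_product (inner_wrt Q) \<and> equivalent_norm (norm_wrt Q) \<and>
       expansive_in_norm m (norm_wrt Q) A \<and> expansive m Q A)"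
proof -
  note T = assms(5) and exp_T = assms(6) and M_def = assms(7) and N_def = assms(8)
    and T1_def = assms(9) and X_def = assms(10) and polar = assms(11) and sqrt = assms(12)
    and A_def = assms(13) and B_def = assms(14) and C_def = assms(15) and D_def = assms(16)
    and Q_def = assms(17)
  define W where "W = T ^^ n"
  have W: "bounded_op W"
    unfolding W_def by (rule bounded_op_funpow[OF T])
  have M: "closed_csubspace M"
    unfolding M_def by (rule closed_csubspace_closure_range[OF W[unfolded W_def]])
  have N_eq: "N = orth_compl M"
    unfolding N_def M_def by (rule kernel_cadjoint_funpow[OF T])
  have N: "closed_csubspace N"
    unfolding N_eq by (rule closed_csubspace_orth_compl)
  have W_in: "W x \<in> M" for x
    unfolding M_def W_def by (rule subsetD[OF closure_subset rangeI])
  then have W_M: "bounded_op_on UNIV M W" and W_MM: "bounded_op_on M M W" and W_NM: "bounded_op_on N M W"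
    using W by (auto simp: bounded_op_on_def)
  have X: "X z = W z" if "z \<in> N" for z
    using that by (simp add: X_def W_def)
  have X_bd: "bounded_op_on N M X"
    by (rule bounded_op_on_cong[OF N W_NM X])
  have T1_pow: "(T1 ^^ n) x = W x" if "x \<in> M" for x
    unfolding T1_def W_def using image_closure_range_funpow[OF T, of _ n, folded M_def] that
    by (rule funpow_restrict(1))
  have F: "bounded_op_on M M (T1 ^^ n)"
    by (rule bounded_op_on_cong[OF M W_MM T1_pow])
  have exp_W: "(\<Sum>j=0..m. (-1) ^ j * real (m choose j) * (norm (W ((W ^^ j) x)))\<^sup>2) \<le> 0" for x
    unfolding W_def by (rule expansive_power_form[OF T exp_T])
  obtain K where K: "norm y \<le> K * norm (W y)" if "y \<in> M" for y
    using expansive_form_bounded_below[OF W exp_W] unfolding M_def W_def by blast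
  have below: "norm x \<le> K * norm ((T1 ^^ n) x)" if "x \<in> M" for x
    using K[OF that] T1_pow[OF that] by simp
  have P_pos: "positive_on M P1" and U: "bounded_op_on M M U1" and W_UP: "\<And>x. x \<in> M \<Longrightarrow> W x = U1 (P1 x)"
    using polar T1_pow
    by (auto simp: polar_decomposition_on_def positive_sqrt_on_def partial_isometry_on_def)
  have P: "bounded_op_on M M P1"
    using P_pos by (simp add: positive_on_def)
  have U_iso: "norm (U1 x) = norm x" if "x \<in> M" for x
    by (rule polar_bounded_below(1)[OF M F polar below that])
  have P_surj: "P1 ` M = M"
    by (rule polar_bounded_below(2)[OF M F polar below])
  have S_pos: "positive_on M S1" and SS: "\<And>x. x \<in> M \<Longrightarrow> S1 (S1 x) = P1 x"
    using sqrt by (auto simp: positive_sqrt_on_def)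
  have S: "bounded_op_on M M S1"
    using S_pos by (simp add: positive_on_def)
  note S_selfadj = positive_on_selfadjoint[OF M S_pos]
  have S_surj: "S1 ` M = M"
  proof (intro equalityI subsetI)
    fix x assume "x \<in> M"
    then obtain y where "y \<in> M" "x = P1 y"
      using P_surj by blast
    then show "x \<in> S1 ` M"
      using SS bounded_op_on_in[OF S] by (metis image_eqI)
  qed (use bounded_op_on_in[OF S] in blast)
  \<comment> \<open>the similarity \<open>P\<^sub>1\<^sup>1\<^sup>/\<^sup>2 \<oplus> I\<close> leads from \<open>T\<^sup>n\<close> to \<open>A\<close>, and \<open>P\<^sub>1 \<oplus> I\<close> leads from \<open>T\<^sup>n\<close> to \<open>B\<close>\<close>
  have C_A: "expansive m C A"
    unfolding C_def A_def N_eq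
    by (rule expansive_gram_block_op[OF M W_M _ U U_iso S _ P _ S S_surj _ exp_W])
       (auto simp: X N_eq S_selfadj SS W_UP)
  have D_B: "expansive m D B"
  proof -
    have "expansive m
        (block_op M N id (id \<circ> adjoint_on M M U1 \<circ> X) (adjoint_on N M X \<circ> U1 \<circ> id) (adjoint_on N M X \<circ> X))
        (block_op M N (P1 \<circ> U1 \<circ> id) (P1 \<circ> X) (\<lambda>_. 0) (\<lambda>_. 0))"
      unfolding N_eq
      by (rule expansive_gram_block_op[OF M W_M _ U U_iso bounded_op_on_id _ bounded_op_on_id _ P P_surj _ exp_W])
         (auto simp: X N_eq W_UP)
    then show ?thesis
      by (simp add: D_def B_def)
  qed
  have extra: "expansive m id B \<and> is_inner_product (inner_wrt Q) \<and> equivalent_norm (norm_wrt Q) \<and>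
      expansive_in_norm m (norm_wrt Q) A \<and> expansive m Q A"
    if ge: "op_le id (block_op M N id X (adjoint_on N M X) (adjoint_on N M X \<circ> X))"
  proof -
    have "z = 0" if "z \<in> orth_compl M" for z
      using gram_block_op_ge_id_trivial[OF M X_bd[unfolded N_eq] ge[unfolded N_eq] that] .
    then have PN: "orth_proj N x = 0" for x
      using orth_proj_in[OF N] by (simp add: N_eq)
    then have PM: "orth_proj M x = x" for x
      using orth_proj_orth_compl[OF M, of x] by (simp add: N_eq)
    then have M_UNIV: "x \<in> M" for x
      using orth_proj_in[OF M, of x] by simp
    then have "M = UNIV"
      by blast
    have W0: "W 0 = 0"
      using bounded_op_on_scaleC[OF W UNIV_I, of 0 0] by simp
    have form_D: "cinner (D x) x = complex_of_real ((norm x)\<^sup>2)" for x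
      using cinner_gram_block_op[OF M W_M _ U U_iso bounded_op_on_id _ bounded_op_on_id, of X x]
      by (simp add: D_def N_eq[symmetric] X PM PN W0 U_iso M_UNIV)
    have form_C: "cinner (C x) x = complex_of_real ((norm (S1 x))\<^sup>2)" for x
      using cinner_gram_block_op[OF M W_M _ U U_iso S S_selfadj P, of X x]
      by (simp add: C_def N_eq[symmetric] X PM PN W0 U_iso M_UNIV SS)
    have Q_bd: "bounded_op Q"
      unfolding Q_def
      by (intro bounded_op_block_op[OF M N] P bounded_op_on_id bounded_op_on_zero
          closed_csubspace_ops(1)[OF M] closed_csubspace_ops(1)[OF N])
    have Q_eq: "inner_wrt Q = (\<lambda>x y. cinner (S1 x) (S1 y))"
      by (intro ext) (simp add: inner_wrt_def Q_def block_op_def PM PN SS[OF M_UNIV, symmetric]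
          S_selfadj M_UNIV)
    then have norm_Q: "norm_wrt Q = (\<lambda>x. norm (S1 x))"
      by (intro ext) (simp add: norm_wrt_def norm_eq_sqrt_cinner)
    have form_Q: "cinner (Q x) x = complex_of_real ((norm (S1 x))\<^sup>2)" for x
      using fun_cong[OF fun_cong[OF Q_eq, of x], of x] by (simp add: inner_wrt_def cinner_self)
    have S': "bounded_op S1"
      using S \<open>M = UNIV\<close> by simp
    obtain J where J: "\<And>x. norm (S1 x) \<le> J * norm x" "J \<ge> 0"
      using bounded_op_on_bound[OF S'] by auto
    have S_below: "norm x \<le> (\<bar>K\<bar> * J) * norm (S1 x)" for x
    proof -
      have "norm x \<le> K * norm (S1 (S1 x))"
        using below[OF M_UNIV, of x] norm_polar_positive_part[OF M F polar M_UNIV, of x]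
        by (simp add: SS M_UNIV)
      also have "\<dots> \<le> \<bar>K\<bar> * norm (S1 (S1 x))"
        by (intro mult_right_mono) auto
      also have "\<dots> \<le> \<bar>K\<bar> * (J * norm (S1 x))"
        by (intro mult_left_mono J) auto
      finally show ?thesis
        by (simp add: mult.assoc)
    qed
    have bd: "bounded_op A" "bounded_op B" "bounded_op C" "bounded_op D"
      using C_A D_B by (simp_all add: expansive_def)
    have id_form: "cinner (id x) x = complex_of_real ((norm x)\<^sup>2)" for x :: 'a
      by (simp add: cinner_self)
    \<comment> \<open>expansivity depends on the weight only through its quadratic form\<close>
    have "expansive m id B"
      using D_B unfolding expansive_iff_form[OF bd(2,4) form_D]
        expansive_iff_form[OF bd(2) bounded_op_on_id id_form] .
    moreover have Q_A: "expansive m Q A"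
      using C_A unfolding expansive_iff_form[OF bd(1,3) form_C] expansive_iff_form[OF bd(1) Q_bd form_Q] .
    moreover have "expansive_in_norm m (norm_wrt Q) A"
      using Q_A unfolding expansive_iff_form[OF bd(1) Q_bd form_Q] by (simp add: expansive_in_norm_def norm_Q)
    ultimately show ?thesis
      using is_inner_product_pullback[OF S' S_below] equivalent_norm_pullback[OF S' S_below]
      by (simp add: Q_eq norm_Q)
  qed
  show ?thesis
    using C_A D_B extra by blast
qed

end
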